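(* There exist a randomized online algorithm for covering integer programs and an absolute constant $C$ such that for every feasible instance $\min\{c^\top x: Ax\ge\mathbf 1,\ \mathbf 0\le x\le u,\ x\in\mathbb{Z}^n\}$ with $A\in\mathbb{R}_{\ge0}^{m\times n}$, $c,u\in\mathbb{R}^n_{\ge0}$ whose rows arrive online, the algorithm maintains a coordinatewise non-decreasing integral vector $X$ which, after each row arrives, satisfies $0\le X\le u$ and all rows received so far, and the final solution satisfies $$\mathbb{E}[c^\top X]\le C\log k\cdot\log \ell\cdot \mathrm{OPT},$$ where $\mathrm{OPT}$ is the optimal value of the instance, $k=\max\{2,\text{row-sparsity of }A\}$ and $\ell=\max\{2,\text{column-sparsity of }A\}$.
   Context: Online CIP: the cost vector $c$ and upper bounds $u$ are known; the rows $\sum_i a_{ij}x_i\ge1$ of $A$ arrive one at a time, and the algorithm may only increase coordinates of its integral solution. The row-sparsity of $A$ is the maximum number of non-zero entries in a row; the column-sparsity is the maximum number of non-zero entries in a column (i.e. the maximum number of constraints a variable appears in). $\log=\log_2$. *)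

theory Defs
  imports "HOL-Probability.Probability" "Jordan_Normal_Form.Matrix"
begin

no_notation inner (infix \<open>\<bullet>\<close> 70)
no_notation vec_nth (infixl \<open>$\<close> 90)

definition cip_solutions :: "real mat \<Rightarrow> real vec \<Rightarrow> int vec set" where
  "cip_solutions A u =
     {x \<in> carrier_vec (dim_col A).
        0\<^sub>v (dim_col A) \<le> x \<and> map_vec real_of_int x \<le> u \<and>
        Matrix.vec (dim_row A) (\<lambda>_. 1) \<le> A *\<^sub>v map_vec real_of_int x}"

definition cip_cost :: "real vec \<Rightarrow> int vec \<Rightarrow> real" where
  "cip_cost c x = c \<bullet> map_vec real_of_int x"

(* For a feasible instance with nonnegative costs the infimum is attained, since the box
   of integral points below u is finite. *)
definition cip_opt :: "real mat \<Rightarrow> real vec \<Rightarrow> real vec \<Rightarrow> real" where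
  "cip_opt A c u = Inf (cip_cost c ` cip_solutions A u)"

(* 0 is inserted so that matrices without rows (columns) have sparsity 0. *)
definition row_sparsity :: "real mat \<Rightarrow> nat" where
  "row_sparsity A =
     Max (insert 0 ((\<lambda>j. card {i. i < dim_col A \<and> A $$ (j, i) \<noteq> 0}) ` {..<dim_row A}))"

definition col_sparsity :: "real mat \<Rightarrow> nat" where
  "col_sparsity A =
     Max (insert 0 ((\<lambda>i. card {j. j < dim_row A \<and> A $$ (j, i) \<noteq> 0}) ` {..<dim_col A}))"

(* The random bits of an algorithm: an infinite sequence of independent uniform numbers
   from the unit interval, drawn independently of the instance. *)
definition random_seed :: "(nat \<Rightarrow> real) measure" where
  "random_seed = (\<Pi>\<^sub>M i\<in>UNIV. uniform_measure lborel {0..1})"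

(* alg w c u rs is the integral solution held by the algorithm run with seed w, cost vector c
   and upper bounds u once exactly the rows rs have arrived, in this order. Neither the
   later rows nor their number (nor the sparsities of the full matrix) are available to it. *)
type_synonym online_cip_alg =
  "(nat \<Rightarrow> real) \<Rightarrow> real vec \<Rightarrow> real vec \<Rightarrow> real vec list \<Rightarrow> int vec"

definition randomized_online_alg :: "online_cip_alg \<Rightarrow> bool" where
  "randomized_online_alg alg \<longleftrightarrow>
     (\<forall>c u rs. (\<lambda>w. alg w c u rs) \<in> random_seed \<rightarrow>\<^sub>M count_space UNIV)"

(* Covers the initial solution (j = 0) and the one after each of the arrivals; holds for every
   outcome of the random bits. In particular the cost of each solution is a bounded random
   variable, hence integrable. *)
definition maintains_solution ::
  "online_cip_alg \<Rightarrow> real mat \<Rightarrow> real vec \<Rightarrow> real vec \<Rightarrow> bool" where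
  "maintains_solution alg A c u \<longleftrightarrow>
     (\<forall>w \<in> space random_seed.
        (\<forall>j \<le> dim_row A. alg w c u (take j (rows A))
             \<in> cip_solutions (mat_of_rows (dim_col A) (take j (rows A))) u) \<and>
        (\<forall>j < dim_row A. alg w c u (take j (rows A)) \<le> alg w c u (take (Suc j) (rows A))))"

end

theory Submission
  imports Defs
begin

text \<open>A fractional vector \<open>x\<close>, not confined to the box, is raised multiplicatively as rows arrive:
  for a row \<open>a\<close> and a boost factor \<open>\<beta>\<close>, let \<open>S\<close> be the set of indices with
  \<open>\<beta> x\<^sub>i \<ge> u\<^sub>i\<close>; while the knapsack-cover inequality of \<open>a\<close> and \<open>S\<close> is violated by a factor of two,
  the other \<open>x\<^sub>i\<close> grow at rate \<open>(a'\<^sub>i x\<^sub>i + 1/k\<^sub>a) / c\<^sub>i\<close>, where \<open>a'\<close> are the knapsack-cover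
  coefficients and \<open>k\<^sub>a\<close> is the support size of \<open>a\<close>. Against an integral solution \<open>z\<close> the potential
  \<open>\<Sum> c\<^sub>i z\<^sub>i ln (1 + K min (x\<^sub>i / z\<^sub>i) 3)\<close> grows at least as fast as one sixth of the cost, whence the
  factor \<open>log k\<close>.

  Independent threshold rounding of \<open>min u (\<beta> x)\<close> with \<open>\<beta> = 16 (ln \<ell> + 1)\<close>, where \<open>\<ell>\<close> is the column sparsity
  seen so far, misses the new row with probability at most \<open>e exp (- \<beta> / 4)\<close>. In that case a cheapest
  cover of this single row is added; it costs at most \<open>2 \<beta>\<close> times the fractional cost on the support of
  the row. Charging these repairs to the columns gives the summable weights \<open>1 / (r (r + 1))\<close>, where \<open>r\<close>
  counts the rows so far that contain the column.\<close>

section \<open>Fractional solution\<close>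

text \<open>Turns growth by a factor \<open>1 + t\<close> into an additive gain of at least
  \<open>t / 2\<close> in a logarithmic potential.\<close>

lemma ln_one_plus_ge_half:
  assumes "0 \<le> (t::real)" "t \<le> 1" shows "t / 2 \<le> ln (1 + t)"
proof -
  have "t - t^2 \<le> ln (1 + t)" using ln_one_plus_pos_lower_bound assms by blast
  show ?thesis
  proof (cases "t \<le> 1/2")
    case True
    then have "t^2 \<le> t/2" using assms mult_left_mono[OF True assms(1)] by (simp add: power2_eq_square)
    then show ?thesis using \<open>t - t^2 \<le> ln (1+t)\<close> by simp
  next
    case False
    have "1 - inverse (1 + t) \<le> ln (1 + t)" using ln_one_minus_pos_lower_bound ln_le_minus_one[of "inverse (1+t)"] assms
      by (simp add: ln_inverse)
    moreover have "t / 2 \<le> 1 - inverse (1 + t)"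
      using assms mult_left_mono[of t 1 t] by (simp add: divide_simps algebra_simps)
    ultimately show ?thesis by simp
  qed
qed

section \<open>Knapsack-cover growth of a fractional vector\<close>

locale covering_box =
  fixes n :: nat and c :: "nat \<Rightarrow> real" and U :: "nat \<Rightarrow> int"
begin

definition cost :: "(nat \<Rightarrow> real) \<Rightarrow> real" where
  "cost x = (\<Sum>i<n. c i * x i)"

definition supp :: "(nat \<Rightarrow> real) \<Rightarrow> nat set" where
  "supp a = {i. i < n \<and> a i \<noteq> 0}"

definition covers :: "(nat \<Rightarrow> real) \<Rightarrow> (nat \<Rightarrow> int) \<Rightarrow> bool" where
  "covers a y \<longleftrightarrow> 1 \<le> (\<Sum>i<n. a i * y i)"

definition in_box :: "(nat \<Rightarrow> int) \<Rightarrow> bool" where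
  "in_box y \<longleftrightarrow> (\<forall>i<n. 0 \<le> y i \<and> y i \<le> U i)"

text \<open>Depends only on the costs, which are known before any row arrives, and makes every
  factor \<open>step_size / c i\<close> with positive \<open>c i\<close> at most
  \<open>1\<close>.\<close>

definition step_size :: real where
  "step_size = (SOME d. 0 < d \<and> (\<forall>i<n. 0 < c i \<longrightarrow> d \<le> c i))"

text \<open>These are the indices where \<open>min (U i) (\<beta> * x i)\<close> equals
  \<open>U i\<close>, so rounding sets them to \<open>U i\<close> with certainty.\<close>

definition saturated :: "real \<Rightarrow> (nat \<Rightarrow> real) \<Rightarrow> nat set" where
  "saturated \<beta> x = {i. i < n \<and> real_of_int (U i) \<le> \<beta> * x i}"

definition residual :: "real \<Rightarrow> (nat \<Rightarrow> real) \<Rightarrow> (nat \<Rightarrow> real) \<Rightarrow> real" where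
  "residual \<beta> a x = 1 - (\<Sum>i\<in>saturated \<beta> x. a i * U i)"

definition kc_coeff :: "real \<Rightarrow> (nat \<Rightarrow> real) \<Rightarrow> (nat \<Rightarrow> real) \<Rightarrow> nat \<Rightarrow> real" where
  "kc_coeff \<beta> a x i = min 1 (a i / residual \<beta> a x)"

definition kc_half_satisfied :: "real \<Rightarrow> (nat \<Rightarrow> real) \<Rightarrow> (nat \<Rightarrow> real) \<Rightarrow> bool" where
  "kc_half_satisfied \<beta> a x \<longleftrightarrow>
     residual \<beta> a x \<le> 0 \<or> 1/2 \<le> (\<Sum>i\<in>{..<n} - saturated \<beta> x. kc_coeff \<beta> a x i * x i)"

text \<open>A discrete step of the continuous growth. The step size works because nonzero coordinates of
  integral solutions are at least \<open>1\<close>: one step from below such a coordinate \<open>z i\<close> stays below \<open>3 * z i\<close>, and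
  the logarithm in the potential stays comparable to its linearization.\<close>

definition raise :: "real \<Rightarrow> (nat \<Rightarrow> real) \<Rightarrow> (nat \<Rightarrow> real) \<Rightarrow> nat \<Rightarrow> real" where
  "raise \<beta> a x i =
     (if i \<in> supp a - saturated \<beta> x
      then x i + step_size * (kc_coeff \<beta> a x i * x i + 1 / card (supp a)) / c i else x i)"

text \<open>For the inputs considered below, a step count passing the test exists because the
  potential is bounded.\<close>

definition raise_until :: "real \<Rightarrow> (nat \<Rightarrow> real) \<Rightarrow> (nat \<Rightarrow> real) \<Rightarrow> nat \<Rightarrow> real" where
  "raise_until \<beta> a x =
     (raise \<beta> a ^^ (LEAST N. kc_half_satisfied \<beta> a ((raise \<beta> a ^^ N) x))) x"

text \<open>The cap at \<open>3\<close> bounds the potential independently of \<open>x\<close>,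
  which may leave the box. Coordinates with \<open>z i = 0\<close> contribute nothing.\<close>

definition potential :: "real \<Rightarrow> (nat \<Rightarrow> int) \<Rightarrow> (nat \<Rightarrow> real) \<Rightarrow> real" where
  "potential K z x = (\<Sum>i<n. c i * z i * ln (1 + K * min (x i / z i) 3))"

lemma step_size: "0 < step_size" "\<And>i. i < n \<Longrightarrow> 0 < c i \<Longrightarrow> step_size \<le> c i"
proof -
  have "\<exists>d. 0 < d \<and> (\<forall>i<n. 0 < c i \<longrightarrow> d \<le> c i)"
  proof (intro exI conjI allI impI)
    let ?S = "insert 1 (c ` {i. i < n \<and> 0 < c i})"
    show "0 < Min ?S" by (subst Min_gr_iff) auto
    show "Min ?S \<le> c i" if "i < n" "0 < c i" for i using that by (intro Min_le) auto
  qed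
  from someI_ex[OF this] show "0 < step_size" "\<And>i. i < n \<Longrightarrow> 0 < c i \<Longrightarrow> step_size \<le> c i"
    unfolding step_size_def by auto
qed

lemma finite_supp [simp]: "finite (supp a)"
  by (simp add: supp_def)

end

section \<open>Potential analysis of the growth\<close>

locale covering_instance = covering_box +
  assumes c_nonneg: "\<And>i. i < n \<Longrightarrow> 0 \<le> c i" and U_nonneg: "\<And>i. i < n \<Longrightarrow> 0 \<le> U i"
begin

text \<open>Integrality of \<open>z\<close> makes the truncation of the coefficients at the residual valid.\<close>

lemma kc_valid:
  fixes x :: "nat \<Rightarrow> real"
  assumes a: "\<And>i. i < n \<Longrightarrow> 0 \<le> a i" and z: "in_box z" "covers a z"
    and pos: "0 < residual \<beta> a x"
  shows "1 \<le> (\<Sum>i\<in>{..<n} - saturated \<beta> x. kc_coeff \<beta> a x i * z i)"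
proof -
  let ?S = "saturated \<beta> x" let ?b = "residual \<beta> a x"
  have S: "?S \<subseteq> {..<n}" by (auto simp: saturated_def)
  have nn: "0 \<le> kc_coeff \<beta> a x i * z i" if "i \<in> {..<n} - ?S" for i
    using that a pos z by (auto simp: kc_coeff_def in_box_def intro!: mult_nonneg_nonneg)
  show ?thesis
  proof (cases "\<exists>i\<in>{..<n} - ?S. ?b \<le> a i \<and> z i \<noteq> 0")
    \<comment> \<open>The truncated coefficient equals \<open>1\<close> and integrality gives
      \<open>z i \<ge> 1\<close>, so this single term suffices.\<close>
    case True
    then obtain i where i: "i \<in> {..<n} - ?S" "?b \<le> a i" "z i \<noteq> 0" by blast
    then have "1 \<le> z i" using z by (force simp: in_box_def)
    then have "1 \<le> kc_coeff \<beta> a x i * z i" using i pos by (simp add: kc_coeff_def)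
    also have "\<dots> \<le> (\<Sum>i\<in>{..<n} - ?S. kc_coeff \<beta> a x i * z i)"
      by (rule member_le_sum) (use i nn in auto)
    finally show ?thesis .
  next
    \<comment> \<open>Now truncation is inactive wherever \<open>z i\<close> is nonzero, so the
      original row, with the saturated indices raised to their upper bounds, can be divided by the
      residual.\<close>
    case False
    have "1 \<le> (\<Sum>i<n. a i * z i)" using z by (simp add: covers_def)
    also have "\<dots> = (\<Sum>i\<in>{..<n} - ?S. a i * z i) + (\<Sum>i\<in>?S. a i * z i)"
      by (rule sum.subset_diff) (use S in auto)
    also have "(\<Sum>i\<in>?S. a i * z i) \<le> (\<Sum>i\<in>?S. a i * U i)"
      using z a S by (intro sum_mono mult_left_mono) (auto simp: in_box_def)
    finally have "?b \<le> (\<Sum>i\<in>{..<n} - ?S. a i * z i)" by (simp add: residual_def)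
    also have "\<dots> = ?b * (\<Sum>i\<in>{..<n} - ?S. kc_coeff \<beta> a x i * z i)"
      unfolding sum_distrib_left
    proof (rule sum.cong)
      fix i assume "i \<in> {..<n} - ?S"
      with False have "a i < ?b \<or> z i = 0" by force
      with pos show "a i * z i = ?b * (kc_coeff \<beta> a x i * z i)"
        by (auto simp: kc_coeff_def min_def divide_simps)
    qed auto
    finally show ?thesis using pos by simp
  qed
qed

lemma raise_ge:
  fixes x :: "nat \<Rightarrow> real"
  assumes a: "\<And>i. i < n \<Longrightarrow> 0 \<le> a i" and x: "\<And>i. i < n \<Longrightarrow> 0 \<le> x i"
    and pos: "0 < residual \<beta> a x"
  shows "x i \<le> raise \<beta> a x i"
  using step_size a x pos c_nonneg
  by (auto simp: raise_def supp_def kc_coeff_def intro!: divide_nonneg_nonneg mult_nonneg_nonneg add_nonneg_nonneg less_imp_le[OF step_size(1)])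

text \<open>Division by \<open>c i\<close> in the growth rate cancels the cost. The violated
  inequality bounds the multiplicative parts of the rate by \<open>1/2\<close> in total, and the
  additive parts \<open>1 / card (supp a)\<close> sum to at most \<open>1\<close>.\<close>

lemma cost_raise:
  fixes x :: "nat \<Rightarrow> real"
  assumes a: "\<And>i. i < n \<Longrightarrow> 0 \<le> a i" and x: "\<And>i. i < n \<Longrightarrow> 0 \<le> x i"
    and \<beta>: "1 \<le> \<beta>" and free: "\<And>i. i < n \<Longrightarrow> c i = 0 \<Longrightarrow> U i \<le> x i"
    and undone: "\<not> kc_half_satisfied \<beta> a x"
  shows "cost (raise \<beta> a x) - cost x \<le> 3/2 * step_size"
proof -
  let ?S = "saturated \<beta> x" let ?I = "supp a - saturated \<beta> x"
  have pos: "0 < residual \<beta> a x" using undone by (auto simp: kc_half_satisfied_def)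
  have knn: "0 \<le> kc_coeff \<beta> a x i" if "i < n" for i using a that pos by (auto simp: kc_coeff_def)
  \<comment> \<open>By \<open>free\<close>, every zero-cost index is saturated, so no raised index
    involves a division by zero.\<close>
  have cpos: "0 < c i" if "i \<in> ?I" for i
  proof (rule ccontr)
    assume "\<not> 0 < c i"
    with that c_nonneg have "c i = 0" by (force simp: supp_def)
    with free that have "U i \<le> x i" by (simp add: supp_def)
    also have "\<dots> \<le> \<beta> * x i" using \<beta> x[of i] that mult_right_mono[of 1 \<beta> "x i"] by (simp add: supp_def)
    finally show False using that by (auto simp: saturated_def supp_def)
  qed
  have sub: "?I \<subseteq> {..<n}" by (auto simp: supp_def)
  have "cost (raise \<beta> a x) - cost x = (\<Sum>i<n. c i * (raise \<beta> a x i - x i))"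
    by (simp add: cost_def sum_subtractf right_diff_distrib)
  also have "\<dots> = (\<Sum>i\<in>?I. c i * (raise \<beta> a x i - x i))"
    by (rule sum.mono_neutral_right) (use sub in \<open>auto simp: raise_def\<close>)
  also have "\<dots> = (\<Sum>i\<in>?I. step_size * (kc_coeff \<beta> a x i * x i + 1 / card (supp a)))"
  proof (rule sum.cong)
    fix i assume i: "i \<in> ?I"
    then have "c i \<noteq> 0" using cpos[OF i] by simp
    with i show "c i * (raise \<beta> a x i - x i) = step_size * (kc_coeff \<beta> a x i * x i + 1 / card (supp a))"
      by (simp add: raise_def)
  qed simp
  also have "\<dots> = step_size * ((\<Sum>i\<in>?I. kc_coeff \<beta> a x i * x i) + card ?I / card (supp a))"
    by (simp add: sum_distrib_left[symmetric] sum.distrib)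
  also have "\<dots> \<le> step_size * (1/2 + 1)"
  proof (intro mult_left_mono add_mono)
    have "(\<Sum>i\<in>?I. kc_coeff \<beta> a x i * x i) \<le> (\<Sum>i\<in>{..<n} - ?S. kc_coeff \<beta> a x i * x i)"
      by (rule sum_mono2) (use sub knn x in auto)
    also have "\<dots> \<le> 1/2" using undone by (simp add: kc_half_satisfied_def)
    finally show "(\<Sum>i\<in>?I. kc_coeff \<beta> a x i * x i) \<le> 1/2" .
    have "card ?I \<le> card (supp a)" by (rule card_mono) auto
    then show "real (card ?I) / real (card (supp a)) \<le> 1"
        by (cases "supp a = {}") (auto simp: card_gt_0_iff)
  qed (use step_size(1) in auto)
  finally show ?thesis by simp
qed

lemma potential_term_mono:
  assumes "0 \<le> (z::int)" "0 \<le> (K::real)" "0 \<le> (x::real)" "x \<le> y" "0 \<le> (d::real)"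
  shows "d * z * ln (1 + K * min (x / z) 3) \<le> d * z * ln (1 + K * min (y / z) 3)"
proof (cases "z = 0")
  case False
  have "K * min (x / z) 3 \<le> K * min (y / z) 3"
    using assms False by (intro mult_left_mono min.mono divide_right_mono) auto
  moreover have "0 \<le> K * min (x / z) 3" using assms False by auto
  ultimately show ?thesis
    using assms by (intro mult_left_mono ln_mono) (linarith | simp)+
qed auto

text \<open>A violated knapsack-cover inequality gives half of its left-hand side at \<open>z\<close> to the
  indices with \<open>x i < z i\<close>, and these make the potential grow. The rate \<open>1 / card (supp a)\<close>
  only has to dominate \<open>1 / K\<close>, so the sparsity of the later rows is irrelevant.\<close>

lemma potential_raise:
  fixes x :: "nat \<Rightarrow> real"
  assumes a: "\<And>i. i < n \<Longrightarrow> 0 \<le> a i" and x: "\<And>i. i < n \<Longrightarrow> 0 \<le> x i"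
    and \<beta>: "1 \<le> \<beta>" and free: "\<And>i. i < n \<Longrightarrow> c i = 0 \<Longrightarrow> U i \<le> x i"
    and undone: "\<not> kc_half_satisfied \<beta> a x"
    and z: "in_box z" "covers a z" and K: "card (supp a) \<le> K"
  shows "step_size / 4 \<le> potential K z (raise \<beta> a x) - potential K z x"
proof -
  let ?S = "saturated \<beta> x" let ?k = "\<lambda>i. kc_coeff \<beta> a x i"
  define L where "L = {i \<in> {..<n} - ?S. x i < z i}"
  have pos: "0 < residual \<beta> a x" using undone by (auto simp: kc_half_satisfied_def)
  have k01: "0 \<le> ?k i" "?k i \<le> 1" if "i < n" for i using a that pos by (auto simp: kc_coeff_def)
  have zn: "0 \<le> z i" if "i < n" for i using z that by (auto simp: in_box_def)
  have "1 \<le> (\<Sum>i\<in>{..<n} - ?S. ?k i * z i)" by (rule kc_valid) (use a z pos in auto)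
  also have "\<dots> = (\<Sum>i\<in>{..<n} - ?S - L. ?k i * z i) + (\<Sum>i\<in>L. ?k i * z i)"
    by (rule sum.subset_diff) (auto simp: L_def)
  also have "(\<Sum>i\<in>{..<n} - ?S - L. ?k i * z i) \<le> (\<Sum>i\<in>{..<n} - ?S - L. ?k i * x i)"
    by (intro sum_mono mult_left_mono) (use k01 in \<open>auto simp: L_def\<close>)
  also have "\<dots> \<le> (\<Sum>i\<in>{..<n} - ?S. ?k i * x i)"
    by (rule sum_mono2) (use k01 x in auto)
  also have "\<dots> \<le> 1/2" using undone by (auto simp: kc_half_satisfied_def)
  finally have half: "1/2 \<le> (\<Sum>i\<in>L. ?k i * z i)" by simp
  \<comment> \<open>Capping each summand at \<open>1\<close> keeps the bound: either some summand
    reaches \<open>1\<close> and suffices alone, or the cap is inactive.\<close>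
  have "1/2 \<le> (\<Sum>i\<in>L. min (?k i * z i) 1)"
  proof (cases "\<exists>i\<in>L. 1 \<le> ?k i * z i")
    case True
    then obtain i where "i \<in> L" "1 \<le> ?k i * z i" by blast
    then have "1 \<le> min (?k i * z i) 1" by simp
    also have "\<dots> \<le> (\<Sum>i\<in>L. min (?k i * z i) 1)"
      by (rule member_le_sum) (use \<open>i \<in> L\<close> k01 zn in \<open>auto simp: L_def\<close>)
    finally show ?thesis by simp
  next
    case False
    then have "(\<Sum>i\<in>L. min (?k i * z i) 1) = (\<Sum>i\<in>L. ?k i * z i)" by (intro sum.cong) auto
    with half show ?thesis by simp
  qed
  then have "step_size / 2 * (1/2) \<le> step_size / 2 * (\<Sum>i\<in>L. min (?k i * z i) 1)"
    using step_size(1) by (intro mult_left_mono) auto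
  then have "step_size / 4 \<le> (\<Sum>i\<in>L. step_size / 2 * min (?k i * z i) 1)"
    by (simp only: sum_distrib_left)
  also have "\<dots> \<le> (\<Sum>i\<in>L. c i * z i * ln (1 + K * min (raise \<beta> a x i / z i) 3)
      - c i * z i * ln (1 + K * min (x i / z i) 3))"
  proof (rule sum_mono)
    fix i assume i: "i \<in> L"
    then have iN: "i < n" and lt: "x i < z i" and nS: "i \<notin> ?S" by (auto simp: L_def)
    have z1: "1 \<le> z i" using lt x[OF iN] by linarith
    show "step_size / 2 * min (?k i * z i) 1
      \<le> c i * z i * ln (1 + K * min (raise \<beta> a x i / z i) 3) - c i * z i * ln (1 + K * min (x i / z i) 3)"
    proof (cases "a i = 0")
      case True
      then show ?thesis using z1 iN by (simp add: kc_coeff_def raise_def supp_def)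
    next
      case False
      then have iI: "i \<in> supp a - ?S" using iN nS by (simp add: supp_def)
      have cpos: "0 < c i"
      proof (rule ccontr)
        assume "\<not> 0 < c i"
        with iN c_nonneg have "c i = 0" by force
        with free iN have "U i \<le> x i" by simp
        with lt z iN show False by (force simp: in_box_def)
      qed
      let ?s = "real (card (supp a))"
      have "supp a \<noteq> {}" using iI by auto
      then have s1: "1 \<le> ?s" by (simp add: Suc_le_eq card_gt_0_iff)
      with K have K1: "1 \<le> real K" by linarith
      have sK: "1 / K \<le> 1 / ?s" using s1 K by (intro divide_left_mono) auto
      \<comment> \<open>\<open>m\<close> is the largest rate with \<open>m \<le> ?k i\<close> and
        \<open>m * z i \<le> 1\<close>. By the first bound the multiplicative part of the growth
        covers \<open>m * x i\<close>; by the second the additive part covers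
        \<open>m * z i / K\<close>.\<close>
      define m where "m = min (?k i) (1 / z i)"
      have m: "0 \<le> m" "m \<le> ?k i" "m * z i \<le> 1" "m \<le> 1"
        using k01[OF iN] z1 by (auto simp: m_def min_def divide_simps)
      have mz: "min (?k i * z i) 1 = m * z i" using z1 by (auto simp: m_def min_def divide_simps)
      \<comment> \<open>The guaranteed relative growth of \<open>x i + z i / K\<close> in this
        step.\<close>
      define t where "t = step_size * m / c i"
      have t: "0 \<le> t" "t \<le> 1"
        using m step_size cpos iN mult_mono[of step_size "c i" m 1] by (auto simp: t_def)
      have xr: "raise \<beta> a x i = x i + step_size / c i * (?k i * x i + 1 / ?s)"
        using iI by (simp add: raise_def)
      have "m * (x i + z i / K) \<le> ?k i * x i + 1 / ?s"
      proof -
        have "m * x i \<le> ?k i * x i" using m x[OF iN] by (intro mult_right_mono)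
        moreover have "m * (z i / K) \<le> 1 / K" using m K1 by (simp add: divide_simps)
        ultimately show ?thesis using sK by (simp add: distrib_left)
      qed
      then have "step_size / c i * (m * (x i + z i / K)) \<le> step_size / c i * (?k i * x i + 1 / ?s)"
        using step_size(1) cpos by (intro mult_left_mono) auto
      then have "t * (x i + z i / K) \<le> raise \<beta> a x i - x i"
        unfolding t_def xr by (simp add: mult.assoc)
      then have grow: "(1 + t) * (x i + z i / K) \<le> raise \<beta> a x i + z i / K"
        by (simp add: distrib_right)
      \<comment> \<open>One step takes \<open>x i\<close> to at most \<open>2 * x i + 1\<close>,
        hence to at most \<open>3 * z i\<close>, so the cap in the potential stays inactive.\<close>
      have "?k i * x i + 1 / ?s \<le> x i + 1"
        using k01[OF iN] x[OF iN] s1 mult_right_mono[of "?k i" 1 "x i"] by (intro add_mono) auto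
      then have "step_size / c i * (?k i * x i + 1 / ?s) \<le> 1 * (x i + 1)"
        using step_size cpos iN k01[OF iN] x[OF iN] by (intro mult_mono) auto
      then have "raise \<beta> a x i \<le> x i + (x i + 1)" unfolding xr mult_1 by (rule add_left_mono)
      moreover have "1 \<le> real_of_int (z i)" using z1 by simp
      ultimately have "raise \<beta> a x i \<le> 3 * real_of_int (z i)" using lt by linarith
      then have r3: "min (raise \<beta> a x i / z i) 3 = raise \<beta> a x i / z i"
        using z1 by (simp add: divide_simps)
      have x3: "min (x i / z i) 3 = x i / z i" using z1 lt by (simp add: min_def divide_simps)
      \<comment> \<open>The argument of the logarithm is a fixed multiple of
        \<open>y + z i / K\<close>, so the relative growth carries over.\<close>
      have conv: "1 + K * (y / z i) = (y + z i / K) * (K / z i)" for y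
        using K1 z1 by (simp add: divide_simps algebra_simps)
      have "(1 + t) * (x i + z i / K) * (K / z i) \<le> (raise \<beta> a x i + z i / K) * (K / z i)"
        using grow z1 by (intro mult_right_mono) auto
      then have le: "(1 + t) * (1 + K * (x i / z i)) \<le> 1 + K * (raise \<beta> a x i / z i)"
        unfolding conv by (simp only: mult.assoc)
      have p: "0 < 1 + K * (x i / z i)" using x[OF iN] z1 by (simp add: add_pos_nonneg)
      have "t / 2 + ln (1 + K * (x i / z i)) \<le> ln (1 + t) + ln (1 + K * (x i / z i))"
        using ln_one_plus_ge_half t by simp
      also have "\<dots> = ln ((1 + t) * (1 + K * (x i / z i)))"
        using t p by (subst ln_mult_pos) auto
      also have "\<dots> \<le> ln (1 + K * (raise \<beta> a x i / z i))"
        using le t p by (intro ln_mono) auto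
      finally have "c i * z i * (t / 2 + ln (1 + K * (x i / z i))) \<le> c i * z i * ln (1 + K * (raise \<beta> a x i / z i))"
        using cpos z1 by (intro mult_left_mono) auto
      moreover have "c i * z i * (t / 2) = step_size / 2 * (m * z i)"
        using cpos by (simp add: t_def)
      ultimately show ?thesis unfolding r3 x3 mz distrib_left by linarith
    qed
  qed
  also have "\<dots> \<le> (\<Sum>i<n. c i * z i * ln (1 + K * min (raise \<beta> a x i / z i) 3)
      - c i * z i * ln (1 + K * min (x i / z i) 3))"
  proof (rule sum_mono2)
    fix i assume i: "i \<in> {..<n} - L"
    then show "0 \<le> c i * z i * ln (1 + K * min (raise \<beta> a x i / z i) 3) - c i * z i * ln (1 + K * min (x i / z i) 3)"
      using potential_term_mono[of "z i" K "x i" "raise \<beta> a x i" "c i"] zn x raise_ge[OF a x pos] c_nonneg by simp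
  qed (auto simp: L_def)
  also have "\<dots> = potential K z (raise \<beta> a x) - potential K z x"
    by (simp add: potential_def sum_subtractf)
  finally show ?thesis .
qed

text \<open>The cap at \<open>3\<close> limits the total growth; this yields both termination and
  the factor log k in the cost.\<close>

lemma potential_bounds:
  fixes x :: "nat \<Rightarrow> real"
  assumes "\<And>i. i < n \<Longrightarrow> 0 \<le> x i" "in_box z"
  shows "0 \<le> potential (real K) z x" "potential (real K) z x \<le> ln (1 + 3 * real K) * cost z"
proof -
  have *: "0 \<le> min (x i / z i) 3" if "i < n" for i using assms that by (auto simp: in_box_def)
  show "0 \<le> potential (real K) z x"
    unfolding potential_def
    using * c_nonneg assms by (intro sum_nonneg mult_nonneg_nonneg ln_ge_zero) (auto simp: in_box_def)
  have "potential (real K) z x \<le> (\<Sum>i<n. c i * z i * ln (1 + 3 * real K))"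
    unfolding potential_def
  proof (intro sum_mono mult_left_mono ln_mono)
    fix i assume i: "i \<in> {..<n}"
    have "K * min (x i / z i) 3 \<le> real K * 3" by (intro mult_left_mono) auto
    then show "1 + K * min (x i / z i) 3 \<le> 1 + 3 * real K" by simp
    have "0 \<le> real K * min (x i / z i) 3" using * i by simp
    then show "0 < 1 + real K * min (x i / z i) 3" by linarith
    show "0 \<le> c i * z i" using assms c_nonneg i by (simp add: in_box_def)
  qed
  then show "potential (real K) z x \<le> ln (1 + 3 * real K) * cost z"
    by (simp add: cost_def sum_distrib_left mult_ac)
qed

text \<open>Every step costs at most \<open>3/2 * step_size\<close> and raises the potential by at
  least \<open>step_size / 4\<close>; the ratio is the constant \<open>6\<close>. As the potential
  is bounded, only finitely many steps occur.\<close>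

lemma raise_until:
  fixes x :: "nat \<Rightarrow> real"
  assumes a: "\<And>i. i < n \<Longrightarrow> 0 \<le> a i" and x: "\<And>i. i < n \<Longrightarrow> 0 \<le> x i"
    and \<beta>: "1 \<le> \<beta>" and free: "\<And>i. i < n \<Longrightarrow> c i = 0 \<Longrightarrow> U i \<le> x i"
    and z: "in_box z" "covers a z"
  shows "kc_half_satisfied \<beta> a (raise_until \<beta> a x)" (is ?done)
    and "\<And>i. x i \<le> raise_until \<beta> a x i" (is "PROP ?mono")
    and "card (supp a) \<le> K \<Longrightarrow> cost x \<le> 6 * potential K z x \<Longrightarrow>
          cost (raise_until \<beta> a x) \<le> 6 * potential K z (raise_until \<beta> a x)" (is "PROP ?cost")
proof -
  let ?r = "\<lambda>N. (raise \<beta> a ^^ N) x"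
  \<comment> \<open>All \<open>K\<close> are treated at once: termination uses
    \<open>K = card (supp a)\<close>, whereas the cost bound needs one \<open>K\<close> shared by
    all rows.\<close>
  have inv: "(\<forall>i. x i \<le> ?r N i) \<and>
      (\<forall>K. card (supp a) \<le> K \<longrightarrow> potential K z x + N * (step_size / 4) \<le> potential K z (?r N)
        \<and> cost (?r N) - cost x \<le> 6 * (potential K z (?r N) - potential K z x))"
    if "\<And>M. M < N \<Longrightarrow> \<not> kc_half_satisfied \<beta> a (?r M)" for N
    using that
  proof (induction N)
    case (Suc N)
    then have IH: "\<And>i. x i \<le> ?r N i" "\<And>K. card (supp a) \<le> K \<Longrightarrow> potential K z x + N * (step_size / 4) \<le> potential K z (?r N)"
      "\<And>K. card (supp a) \<le> K \<Longrightarrow> cost (?r N) - cost x \<le> 6 * (potential K z (?r N) - potential K z x)"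
      by auto
    have un: "\<not> kc_half_satisfied \<beta> a (?r N)" using Suc.prems by simp
    have rx: "0 \<le> ?r N i" if "i < n" for i using x[OF that] IH(1)[of i] by linarith
    have rf: "U i \<le> ?r N i" if "i < n" "c i = 0" for i using free[OF that] IH(1)[of i] by linarith
    have "0 < residual \<beta> a (?r N)" using un by (auto simp: kc_half_satisfied_def)
    then have ge: "?r N i \<le> ?r (Suc N) i" for i using raise_ge[OF a rx] by simp
    show ?case
    proof (intro conjI allI impI)
      fix i show "x i \<le> ?r (Suc N) i" using ge[of i] IH(1)[of i] by linarith
    next
      fix K assume K: "card (supp a) \<le> K"
      have p: "step_size / 4 \<le> potential K z (?r (Suc N)) - potential K z (?r N)"
        unfolding funpow.simps comp_apply by (rule potential_raise[OF a rx \<beta> rf un z K])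
      have q: "cost (?r (Suc N)) - cost (?r N) \<le> 3/2 * step_size"
        unfolding funpow.simps comp_apply by (rule cost_raise[OF a rx \<beta> rf un])
      show "potential K z x + Suc N * (step_size / 4) \<le> potential K z (?r (Suc N))"
        using p IH(2)[OF K] unfolding of_nat_Suc distrib_right by linarith
      show "cost (?r (Suc N)) - cost x \<le> 6 * (potential K z (?r (Suc N)) - potential K z x)"
        using p q IH(3)[OF K] by (simp add: algebra_simps del: funpow.simps)
    qed
  qed auto
  have ex: "\<exists>N. kc_half_satisfied \<beta> a (?r N)"
  proof (rule ccontr)
    assume "\<not> (\<exists>N. kc_half_satisfied \<beta> a (?r N))"
    then have inv': "x i \<le> ?r N i"
      "potential (card (supp a)) z x + N * (step_size / 4) \<le> potential (card (supp a)) z (?r N)" for i N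
      using inv[of N] by auto
    define B where "B = ln (1 + 3 * real (card (supp a))) * cost z"
    obtain N where N: "B < real N * (step_size / 4)"
      using reals_Archimedean3[of "step_size / 4"] step_size(1) by auto
    have "0 \<le> ?r N i" if "i < n" for i using x[OF that] inv'(1)[of i N] by linarith
    then have "potential (card (supp a)) z (?r N) \<le> B"
      unfolding B_def by (intro potential_bounds z) auto
    moreover have "0 \<le> potential (card (supp a)) z x" using x z by (intro potential_bounds) auto
    ultimately show False using inv'(2)[of N] N by linarith
  qed
  define N where "N = (LEAST N. kc_half_satisfied \<beta> a (?r N))"
  have r: "raise_until \<beta> a x = ?r N" by (simp add: raise_until_def N_def)
  show ?done unfolding r N_def using ex by (rule LeastI_ex)
  have *: "\<not> kc_half_satisfied \<beta> a (?r M)" if "M < N" for M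
    using that unfolding N_def by (rule not_less_Least)
  show "PROP ?mono" using inv[OF *] r by auto
  show "PROP ?cost"
  proof -
    assume "card (supp a) \<le> K" "cost x \<le> 6 * potential K z x"
    then show ?thesis using inv[OF *] r by force
  qed
qed

end

section \<open>Randomized rounding and repair\<close>

lemma prob_space_uniform_unit: "prob_space (uniform_measure lborel {0..1::real})"
  by (rule prob_space_uniform_measure) auto

lemma prob_space_random_seed: "prob_space random_seed"
  unfolding random_seed_def by (intro prob_space_PiM prob_space_uniform_unit)

lemma space_random_seed [simp]: "space random_seed = UNIV"
  by (simp add: random_seed_def space_PiM)

lemma measurable_seed_component [measurable]: "(\<lambda>w. w i) \<in> borel_measurable random_seed"
proof -
  have "(\<lambda>w. w i) \<in> random_seed \<rightarrow>\<^sub>M uniform_measure lborel {0..1::real}"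
    unfolding random_seed_def by (rule measurable_component_singleton) auto
  then show ?thesis by (simp add: measurable_def)
qed

lemma distr_seed_component:
  "distr random_seed (uniform_measure lborel {0..1}) (\<lambda>w. w i) = uniform_measure lborel {0..1}"
  unfolding random_seed_def by (rule distr_PiM_component) (auto intro: prob_space_uniform_unit)

lemma indep_seed_components:
  "prob_space.indep_vars random_seed (\<lambda>_. uniform_measure lborel {0..1}) (\<lambda>i w. w i) UNIV"
proof (subst prob_space.indep_vars_iff_distr_eq_PiM[OF prob_space_random_seed])
  show "(\<lambda>w. w i) \<in> random_seed \<rightarrow>\<^sub>M uniform_measure lborel {0..1::real}" for i
    unfolding random_seed_def by (rule measurable_component_singleton) auto
  have "distr random_seed (Pi\<^sub>M UNIV (\<lambda>i. uniform_measure lborel {0..1})) (\<lambda>w. w) = random_seed"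
    by (rule distr_id2) (simp add: random_seed_def)
  then show "distr random_seed (Pi\<^sub>M UNIV (\<lambda>i. uniform_measure lborel {0..1})) (\<lambda>w. \<lambda>i\<in>UNIV. w i) =
      Pi\<^sub>M UNIV (\<lambda>i. distr random_seed (uniform_measure lborel {0..1}) (\<lambda>w. w i))"
    by (simp add: distr_seed_component restrict_def) (simp add: random_seed_def)
qed auto

lemma measure_seed_component_less:
  assumes "0 \<le> p" "p \<le> 1"
  shows "measure random_seed {w. 0 \<le> w i \<and> w i < p} = p"
proof -
  have "measure random_seed {w. 0 \<le> w i \<and> w i < p}
      = measure (distr random_seed (uniform_measure lborel {0..1}) (\<lambda>w. w i)) {0..<p}"
    by (subst measure_distr) (auto simp: random_seed_def space_PiM intro!: arg_cong2[where f = measure] measurable_component_singleton)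
  also have "\<dots> = measure lborel ({0..1} \<inter> {0..<p}) / measure lborel {0..1::real}"
    unfolding distr_seed_component by (rule measure_uniform_measure) auto
  also have "{0..1} \<inter> {0..<p} = {0..<p}" using assms by auto
  finally show ?thesis using assms by simp
qed

text \<open>The threshold test is written so that rounding behaves for every \<open>t\<close>, including the
  outcomes outside the unit interval that the seed space contains.\<close>

definition round_at :: "real \<Rightarrow> real \<Rightarrow> int" where
  "round_at v t = \<lfloor>v\<rfloor> + (if 0 \<le> t \<and> t < frac v then 1 else 0)"

text \<open>Reusing one threshold for all values makes the rounded solution monotone over time.
  Within a unit interval the fractional part grows; a larger integer part makes up for losing the
  extra \<open>1\<close>.\<close>

lemma round_at_mono:
  assumes "v \<le> v'" shows "round_at v t \<le> round_at v' t"
proof (cases "\<lfloor>v\<rfloor> = \<lfloor>v'\<rfloor>")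
  case True
  then have "frac v \<le> frac v'" using assms by (simp add: frac_def)
  with True show ?thesis by (auto simp: round_at_def)
next
  case False
  then have "\<lfloor>v\<rfloor> < \<lfloor>v'\<rfloor>" using floor_mono[OF assms] by linarith
  then show ?thesis by (auto simp: round_at_def)
qed

lemma round_at_of_int [simp]: "round_at (of_int k) t = k"
  by (simp add: round_at_def)

lemma round_at_measurable [measurable]:
  "(\<lambda>w. round_at v (w i)) \<in> random_seed \<rightarrow>\<^sub>M count_space UNIV"
  unfolding round_at_def by measurable

text \<open>Rounding takes only the values \<open>\<lfloor>v\<rfloor>\<close> and
  \<open>\<lfloor>v\<rfloor> + 1\<close>, the latter with probability \<open>frac v\<close>, so
  every function of it is affine in one indicator.\<close>

lemma
  fixes f :: "int \<Rightarrow> real"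
  shows integrable_round_at: "integrable random_seed (\<lambda>w. f (round_at v (w i)))"
    and integral_round_at:
      "(\<integral>w. f (round_at v (w i)) \<partial>random_seed) = (1 - frac v) * f \<lfloor>v\<rfloor> + frac v * f (\<lfloor>v\<rfloor> + 1)"
proof -
  interpret prob_space random_seed by (rule prob_space_random_seed)
  let ?A = "{w. 0 \<le> w i \<and> w i < frac v}"
  have A: "?A \<in> sets random_seed"
  proof -
    have "{w \<in> space random_seed. 0 \<le> w i \<and> w i < frac v} \<in> sets random_seed" by measurable
    then show ?thesis by simp
  qed
  have eq: "f (round_at v (w i)) = f \<lfloor>v\<rfloor> + (f (\<lfloor>v\<rfloor> + 1) - f \<lfloor>v\<rfloor>) * indicator ?A w" for w
    by (auto simp: round_at_def indicator_def)
  have int: "integrable random_seed (indicator ?A :: _ \<Rightarrow> real)"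
    using A by (auto intro!: integrable_real_indicator simp: emeasure_eq_measure)
  show "integrable random_seed (\<lambda>w. f (round_at v (w i)))"
    unfolding eq using int by auto
  have "measure random_seed ?A = frac v"
    by (rule measure_seed_component_less) (auto simp: frac_ge_0 less_imp_le[OF frac_lt_1])
  then show "(\<integral>w. f (round_at v (w i)) \<partial>random_seed) = (1 - frac v) * f \<lfloor>v\<rfloor> + frac v * f (\<lfloor>v\<rfloor> + 1)"
    unfolding eq using int A by (subst Bochner_Integration.integral_add) (auto simp: algebra_simps prob_space[simplified])
qed

lemma integral_round_at_id: "(\<integral>w. round_at v (w i) \<partial>random_seed) = v"
  by (subst integral_round_at[where f = real_of_int]) (simp add: frac_def algebra_simps)

text \<open>One factor of the exponential-moment bound. The estimate
  \<open>exp (- s) \<le> 1 - s / 2\<close> handles the random fractional part; the deterministic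
  integer part satisfies the bound with room to spare.\<close>

lemma integral_exp_round_at:
  fixes v s :: real
  assumes v: "0 \<le> v" and s: "0 \<le> s" "s \<le> 1"
  shows "(\<integral>w. exp (- (s * round_at v (w i))) \<partial>random_seed) \<le> exp (- (s * v / 2))"
proof -
  let ?p = "frac v" let ?k = "\<lfloor>v\<rfloor>"
  have p: "0 \<le> ?p" "?p \<le> 1" by (auto simp: frac_ge_0 less_imp_le[OF frac_lt_1])
  have k: "0 \<le> real_of_int ?k" using v by simp
  have "exp (-s) \<le> 1 - s/2"
  proof -
    have "exp (-s) = inverse (exp s)" by (rule exp_minus)
    also have "\<dots> \<le> inverse (1 + s)" using s exp_ge_add_one_self[of s] by (intro le_imp_inverse_le) auto
    also have "\<dots> \<le> 1 - s/2"
      using s mult_left_mono[of s 1 s] by (simp add: divide_simps algebra_simps)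
    finally show ?thesis .
  qed
  then have "?p * exp (-s) \<le> ?p * (1 - s/2)" using p by (intro mult_left_mono)
  then have 1: "1 - ?p + ?p * exp (-s) \<le> 1 + - (s * ?p / 2)" by (simp add: algebra_simps)
  also have "\<dots> \<le> exp (- (s * ?p / 2))" by (rule exp_ge_add_one_self)
  finally have 2: "1 - ?p + ?p * exp (-s) \<le> exp (- (s * ?p / 2))" .
  have "(\<integral>w. exp (- (s * round_at v (w i))) \<partial>random_seed)
      = (1 - ?p) * exp (- (s * ?k)) + ?p * exp (- (s * (?k + 1)))"
    by (subst integral_round_at[where f = "\<lambda>r. exp (- (s * real_of_int r))"]) simp
  also have "\<dots> = exp (- (s * ?k)) * (1 - ?p + ?p * exp (-s))"
    by (simp add: algebra_simps exp_add[symmetric])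
  also have "\<dots> \<le> exp (- (s * ?k / 2)) * exp (- (s * ?p / 2))"
    using 2 s k p by (intro mult_mono) auto
  also have "\<dots> = exp (- (s * v / 2))"
    by (simp add: exp_add[symmetric] frac_def algebra_simps diff_divide_distrib)
  finally show ?thesis .
qed

section \<open>Rounding a vector and repairing a single row\<close>

context covering_box
begin

definition rounded :: "real \<Rightarrow> (nat \<Rightarrow> real) \<Rightarrow> (nat \<Rightarrow> real) \<Rightarrow> nat \<Rightarrow> int" where
  "rounded \<beta> x w i = round_at (min (real_of_int (U i)) (\<beta> * x i)) (w i)"

text \<open>Fixing the entries from \<open>n\<close> on leaves finitely many candidates, so a
  minimum exists whenever there is a candidate.\<close>

definition repair :: "(nat \<Rightarrow> real) \<Rightarrow> nat \<Rightarrow> int" where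
  "repair a = arg_min_on (\<lambda>y. cost (\<lambda>i. y i)) {y. in_box y \<and> covers a y \<and> (\<forall>i. n \<le> i \<longrightarrow> y i = 0)}"

lemma rounded_measurable [measurable]:
  "(\<lambda>w. rounded \<beta> x w i) \<in> random_seed \<rightarrow>\<^sub>M count_space UNIV"
  unfolding rounded_def by measurable

lemma covers_rounded_sets: "{w. \<not> covers a (rounded \<beta> x w)} \<in> sets random_seed"
proof -
  have "{w \<in> space random_seed. \<not> covers a (rounded \<beta> x w)} \<in> sets random_seed"
    unfolding covers_def by measurable
  then show ?thesis by simp
qed

lemma finite_box: "finite {y. in_box y \<and> (\<forall>i. n \<le> i \<longrightarrow> y i = 0)}"
proof (rule finite_subset)
  let ?B = "\<Union>i<n. {0..U i}"
  show "{y. in_box y \<and> (\<forall>i. n \<le> i \<longrightarrow> y i = 0)}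
      \<subseteq> {y. \<forall>i. (i \<in> {..<n} \<longrightarrow> y i \<in> ?B) \<and> (i \<notin> {..<n} \<longrightarrow> y i = 0)}"
    by (force simp: in_box_def)
  show "finite {y. \<forall>i. (i \<in> {..<n} \<longrightarrow> y i \<in> ?B) \<and> (i \<notin> {..<n} \<longrightarrow> y i = (0::int))}"
    by (rule finite_set_of_finite_funs) auto
qed

lemma
  assumes "in_box z" "covers a z"
  shows repair_in_box: "in_box (repair a)" and covers_repair: "covers a (repair a)"
    and cost_repair_le: "\<And>y. in_box y \<Longrightarrow> covers a y \<Longrightarrow> cost (\<lambda>i. repair a i) \<le> cost (\<lambda>i. y i)"
proof -
  let ?P = "{y. in_box y \<and> covers a y \<and> (\<forall>i. n \<le> i \<longrightarrow> y i = 0)}"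
  let ?cut = "\<lambda>y i. if i < n then y i else 0"
  have cut: "?cut y \<in> ?P" if "in_box y" "covers a y" for y
    using that by (auto simp: in_box_def covers_def)
  have fin: "finite ?P" by (rule finite_subset[OF _ finite_box]) auto
  have ne: "?P \<noteq> {}" using cut[OF assms] by blast
  have "repair a \<in> ?P" unfolding repair_def by (rule arg_min_if_finite(1)[OF fin ne])
  then show "in_box (repair a)" "covers a (repair a)" by auto
  fix y assume "in_box y" "covers a y"
  then have "cost (\<lambda>i. repair a i) \<le> cost (\<lambda>i. ?cut y i)"
    unfolding repair_def by (intro arg_min_least[OF fin ne] cut)
  also have "\<dots> = cost (\<lambda>i. y i)" by (simp add: cost_def)
  finally show "cost (\<lambda>i. repair a i) \<le> cost (\<lambda>i. y i)" .
qed

end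

context covering_instance
begin

text \<open>The capped value lies between the integers \<open>0\<close> and \<open>U i\<close>,
  which rounding fixes, so monotonicity confines the result.\<close>

lemma rounded_in_box:
  fixes x :: "nat \<Rightarrow> real"
  assumes "\<And>i. i < n \<Longrightarrow> 0 \<le> x i" "0 \<le> \<beta>"
  shows "in_box (rounded \<beta> x w)"
  unfolding in_box_def
proof (intro allI impI conjI)
  fix i assume i: "i < n"
  have "round_at (of_int 0) (w i) \<le> rounded \<beta> x w i"
    unfolding rounded_def using i assms U_nonneg by (intro round_at_mono) auto
  then show "0 \<le> rounded \<beta> x w i" by (simp only: round_at_of_int)
  have "rounded \<beta> x w i \<le> round_at (of_int (U i)) (w i)"
    unfolding rounded_def by (intro round_at_mono) auto
  then show "rounded \<beta> x w i \<le> U i" by simp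
qed

lemma integral_cost_rounded_le:
  fixes x :: "nat \<Rightarrow> real"
  assumes "\<And>i. i < n \<Longrightarrow> 0 \<le> x i" "0 \<le> \<beta>" "I \<subseteq> {..<n}"
  shows "(\<integral>w. (\<Sum>i\<in>I. c i * rounded \<beta> x w i) \<partial>random_seed) \<le> \<beta> * (\<Sum>i\<in>I. c i * x i)"
proof -
  have "(\<integral>w. (\<Sum>i\<in>I. c i * rounded \<beta> x w i) \<partial>random_seed) = (\<Sum>i\<in>I. c i * min (real_of_int (U i)) (\<beta> * x i))"
    unfolding rounded_def
    by (subst Bochner_Integration.integral_sum)
      (auto simp: integral_round_at_id intro!: integrable_mult_right integrable_round_at[where f = real_of_int])
  also have "\<dots> \<le> (\<Sum>i\<in>I. c i * (\<beta> * x i))"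
    using assms c_nonneg by (intro sum_mono mult_left_mono) auto
  finally show ?thesis by (simp add: sum_distrib_left mult_ac)
qed

text \<open>Markov's inequality for \<open>exp (- \<Sum> k i * R i)\<close>, the sum running over the unsaturated
  indices; the saturated ones are rounded to their upper bounds.\<close>

lemma prob_not_covers_rounded:
  fixes x :: "nat \<Rightarrow> real"
  assumes a: "\<And>i. i < n \<Longrightarrow> 0 \<le> a i" and x: "\<And>i. i < n \<Longrightarrow> 0 \<le> x i" and \<beta>: "0 \<le> \<beta>"
    and kc: "kc_half_satisfied \<beta> a x"
  shows "measure random_seed {w. \<not> covers a (rounded \<beta> x w)} \<le> exp 1 * exp (- \<beta> / 4)"
proof -
  interpret prob_space random_seed by (rule prob_space_random_seed)
  let ?S = "saturated \<beta> x" let ?J = "{..<n} - saturated \<beta> x"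
  let ?k = "\<lambda>i. kc_coeff \<beta> a x i" let ?b = "residual \<beta> a x"
  let ?R = "\<lambda>w. rounded \<beta> x w"
  have S: "?S \<subseteq> {..<n}" by (auto simp: saturated_def)
  have R0: "0 \<le> ?R w i" if "i < n" for w i using rounded_in_box[OF x \<beta>] that by (auto simp: in_box_def)
  have RS: "?R w i = U i" if "i \<in> ?S" for w i
    using that by (simp add: saturated_def rounded_def min_absorb1)
  \<comment> \<open>Saturated indices contribute exactly \<open>1 - ?b\<close>, so the row fails
    precisely when the other indices contribute less than \<open>?b\<close>.\<close>
  have split: "(\<Sum>i<n. a i * ?R w i) = (\<Sum>i\<in>?J. a i * ?R w i) + (1 - ?b)" for w
    using sum.subset_diff[OF S, of "\<lambda>i. a i * ?R w i"] by (simp add: residual_def RS)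
  show ?thesis
  proof (cases "?b \<le> 0")
    case True
    have "covers a (?R w)" for w
    proof -
      have "0 \<le> (\<Sum>i\<in>?J. a i * ?R w i)" using a R0 by (intro sum_nonneg mult_nonneg_nonneg) auto
      then show ?thesis using split[of w] True by (simp add: covers_def)
    qed
    then show ?thesis by simp
  next
    case False
    then have b: "0 < ?b" by simp
    have k: "0 \<le> ?k i" "?k i \<le> 1" "?b * ?k i \<le> a i" if "i < n" for i
      using a[OF that] b by (auto simp: kc_coeff_def min_def divide_simps)
    have half: "1/2 \<le> (\<Sum>i\<in>?J. ?k i * x i)" using kc False by (simp add: kc_half_satisfied_def)
    let ?g = "\<lambda>w. \<Prod>i\<in>?J. exp (- (?k i * ?R w i))"
    have ind: "indep_vars (\<lambda>_. borel) (\<lambda>i w. exp (- (?k i * ?R w i))) ?J"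
      unfolding rounded_def
      by (rule indep_vars_compose2[OF indep_vars_subset[OF indep_seed_components]])
        (auto simp: round_at_def measurable_cong_sets[OF sets_uniform_measure refl])
    have int: "integrable random_seed (\<lambda>w. exp (- (?k i * ?R w i)))" for i
      unfolding rounded_def by (rule integrable_round_at)
    have "measure random_seed {w. \<not> covers a (?R w)} = (\<integral>w. indicator {w. \<not> covers a (?R w)} w \<partial>random_seed)"
      using covers_rounded_sets by simp
    also have "\<dots> \<le> (\<integral>w. exp 1 * ?g w \<partial>random_seed)"
    proof (rule integral_mono')
      show "integrable random_seed (\<lambda>w. exp 1 * ?g w)"
        by (intro integrable_mult_right indep_vars_integrable ind int) auto
      fix w
      show "0 \<le> exp 1 * ?g w" by (intro mult_nonneg_nonneg prod_nonneg) auto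
      show "indicator {w. \<not> covers a (?R w)} w \<le> exp 1 * ?g w"
      proof (cases "covers a (?R w)")
        case False
        \<comment> \<open>On failure the sum weighted by the knapsack-cover coefficients is below
          \<open>1\<close>; exponentiation then bounds the indicator of failure.\<close>
        have "?b * (\<Sum>i\<in>?J. ?k i * ?R w i) \<le> (\<Sum>i\<in>?J. a i * ?R w i)"
          unfolding sum_distrib_left mult.assoc[symmetric]
          using k R0 by (intro sum_mono mult_right_mono) auto
        also have "\<dots> < ?b * 1" using False split[of w] by (simp add: covers_def)
        finally have "(\<Sum>i\<in>?J. ?k i * ?R w i) < 1" using b by (simp only: mult_less_cancel_left_pos)
        then have "1 \<le> exp (1 + - (\<Sum>i\<in>?J. ?k i * ?R w i))" by simp
        also have "\<dots> = exp 1 * ?g w" by (simp only: exp_add sum_negf[symmetric] exp_sum[OF finite_Diff[OF finite_lessThan]])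
        finally show ?thesis using False by simp
      qed (auto intro!: mult_nonneg_nonneg prod_nonneg)
    qed
    also have "\<dots> = exp 1 * (\<Prod>i\<in>?J. \<integral>w. exp (- (?k i * ?R w i)) \<partial>random_seed)"
      by (simp add: indep_vars_lebesgue_integral[OF _ ind int])
    also have "\<dots> \<le> exp 1 * (\<Prod>i\<in>?J. exp (- (?k i * (\<beta> * x i) / 2)))"
    proof (intro mult_left_mono prod_mono conjI)
      fix i assume i: "i \<in> ?J"
      then have "min (real_of_int (U i)) (\<beta> * x i) = \<beta> * x i" by (auto simp: saturated_def)
      then have r: "?R w i = round_at (\<beta> * x i) (w i)" for w by (simp add: rounded_def)
      show "(\<integral>w. exp (- (?k i * ?R w i)) \<partial>random_seed) \<le> exp (- (?k i * (\<beta> * x i) / 2))"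
        unfolding r using i k \<beta> x by (intro integral_exp_round_at) auto
      show "0 \<le> (\<integral>w. exp (- (?k i * ?R w i)) \<partial>random_seed)" by (intro Bochner_Integration.integral_nonneg) auto
    qed auto
    also have "\<dots> = exp 1 * exp (- (\<beta> / 2 * (\<Sum>i\<in>?J. ?k i * x i)))"
      by (simp add: exp_sum[symmetric] sum_negf sum_distrib_left mult_ac)
    also have "\<dots> \<le> exp 1 * exp (- \<beta> / 4)"
      using mult_left_mono[OF half, of "\<beta> / 2"] \<beta> by simp
    finally show ?thesis .
  qed
qed

text \<open>The probabilistic method: rounding produces a cover of the row with probability at least
  one half, so some cover costs at most twice the expected cost of the rounding on the row.\<close>

lemma cost_repair:
  fixes x :: "nat \<Rightarrow> real"
  assumes z: "in_box z" "covers a z"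
    and x: "\<And>i. i < n \<Longrightarrow> 0 \<le> x i" and \<beta>: "0 \<le> \<beta>"
    and half: "measure random_seed {w. \<not> covers a (rounded \<beta> x w)} \<le> 1/2"
  shows "cost (\<lambda>i. repair a i) \<le> 2 * \<beta> * (\<Sum>i\<in>supp a. c i * x i)"
proof -
  interpret prob_space random_seed by (rule prob_space_random_seed)
  let ?M = "cost (\<lambda>i. repair a i)" let ?F = "{w. \<not> covers a (rounded \<beta> x w)}"
  let ?R = "\<lambda>w. rounded \<beta> x w"
  have F: "?F \<in> events" by (rule covers_rounded_sets)
  have R: "in_box (?R w)" for w by (rule rounded_in_box[OF x \<beta>])
  have sub: "supp a \<subseteq> {..<n}" by (auto simp: supp_def)
  have M0: "0 \<le> ?M" using repair_in_box[OF z] c_nonneg by (auto simp: cost_def in_box_def intro!: sum_nonneg)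
  have int: "integrable random_seed (\<lambda>w. \<Sum>i\<in>supp a. c i * ?R w i)"
    unfolding rounded_def by (intro Bochner_Integration.integrable_sum integrable_mult_right integrable_round_at)
  have int1: "integrable random_seed (\<lambda>w. ?M * (1 - indicator ?F w))"
    using F by (intro integrable_mult_right Bochner_Integration.integrable_diff integrable_real_indicator) (auto simp: emeasure_eq_measure)
  have "?M * (1 - prob ?F) = (\<integral>w. ?M * (1 - indicator ?F w) \<partial>random_seed)"
    using F by (simp add: Bochner_Integration.integral_diff integrable_real_indicator emeasure_eq_measure prob_space[simplified])
  also have "\<dots> \<le> (\<integral>w. (\<Sum>i\<in>supp a. c i * ?R w i) \<partial>random_seed)"
  proof (rule integral_mono[OF int1 int])
    fix w
    show "?M * (1 - indicator ?F w) \<le> (\<Sum>i\<in>supp a. c i * ?R w i)"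
    proof (cases "w \<in> ?F")
      case True
      then show ?thesis using R[of w] c_nonneg sub by (auto simp: in_box_def intro!: sum_nonneg mult_nonneg_nonneg)
    next
      case False
      \<comment> \<open>Dropping the entries outside the support keeps the cover and leaves exactly
        the cost on the support, which a cheapest cover cannot exceed.\<close>
      let ?y = "\<lambda>i. if i \<in> supp a then ?R w i else 0"
      have "covers a ?y"
      proof -
        have "(\<Sum>i<n. a i * ?y i) = (\<Sum>i<n. a i * ?R w i)" by (rule sum.cong) (auto simp: supp_def)
        then show ?thesis using False by (simp add: covers_def)
      qed
      moreover have "in_box ?y" using R[of w] U_nonneg by (auto simp: in_box_def)
      ultimately have "?M \<le> cost (\<lambda>i. ?y i)" by (intro cost_repair_le[OF z])
      also have "\<dots> = (\<Sum>i\<in>supp a. c i * ?R w i)"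
        unfolding cost_def by (rule sum.mono_neutral_cong_right) (use sub in auto)
      finally show ?thesis using False by simp
    qed
  qed
  also have "\<dots> \<le> \<beta> * (\<Sum>i\<in>supp a. c i * x i)"
    by (rule integral_cost_rounded_le[OF x \<beta> sub])
  finally have "?M * (1 - prob ?F) \<le> \<beta> * (\<Sum>i\<in>supp a. c i * x i)" .
  moreover have "?M * (1/2) \<le> ?M * (1 - prob ?F)" using half M0 by (intro mult_left_mono) auto
  ultimately show ?thesis by simp
qed

end

section \<open>The online algorithm\<close>

context covering_box
begin

text \<open>Histories list the rows received so far, the most recent one first.\<close>

definition col_count :: "(nat \<Rightarrow> real) list \<Rightarrow> nat \<Rightarrow> nat" where
  "col_count q i = length (filter (\<lambda>a. a i \<noteq> 0) q)"

definition max_col_count :: "(nat \<Rightarrow> real) list \<Rightarrow> nat" where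
  "max_col_count q = Max (insert 2 (col_count q ` {..<n}))"

text \<open>The constant makes \<open>exp (- boost q / 4)\<close> decay like the inverse fourth
  power of the column sparsity, which pays for the factor \<open>2 * boost q\<close> and for the
  telescoping weights. Being at least \<open>16\<close>, it also keeps the failure probability below
  one half.\<close>

definition boost :: "(nat \<Rightarrow> real) list \<Rightarrow> real" where
  "boost q = 16 * (ln (max_col_count q) + 1)"

text \<open>Zero-cost variables start at their upper bounds: this is free and keeps them saturated,
  so the growth never divides by a zero cost.\<close>

primrec fractional :: "(nat \<Rightarrow> real) list \<Rightarrow> nat \<Rightarrow> real" where
  "fractional [] = (\<lambda>i. if c i = 0 then U i else 0)"
| "fractional (a # q) = raise_until (boost (a # q)) a (fractional q)"

definition rounding :: "(nat \<Rightarrow> real) list \<Rightarrow> (nat \<Rightarrow> real) \<Rightarrow> nat \<Rightarrow> int" where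
  "rounding q = rounded (boost q) (fractional q)"

primrec repairs :: "(nat \<Rightarrow> real) list \<Rightarrow> (nat \<Rightarrow> real) \<Rightarrow> nat \<Rightarrow> int" where
  "repairs [] w i = 0"
| "repairs (a # q) w i = repairs q w i + (if covers a (rounding (a # q) w) then 0 else repair a i)"

text \<open>Capping at \<open>U i\<close> does not endanger coverage, since the rounding and each
  single repair already lie in the box.\<close>

definition solution :: "(nat \<Rightarrow> real) list \<Rightarrow> (nat \<Rightarrow> real) \<Rightarrow> nat \<Rightarrow> int" where
  "solution q w i = min (U i) (rounding q w i + repairs q w i)"

definition feasible :: "(nat \<Rightarrow> real) list \<Rightarrow> (nat \<Rightarrow> int) \<Rightarrow> bool" where
  "feasible q z \<longleftrightarrow> in_box z \<and> (\<forall>a\<in>set q. (\<forall>i<n. 0 \<le> a i) \<and> covers a z)"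

lemma feasible_Cons:
  "feasible (a # q) z \<longleftrightarrow> (\<forall>i<n. 0 \<le> a i) \<and> covers a z \<and> feasible q z"
  by (auto simp: feasible_def)

lemma repairs_measurable [measurable]:
  "(\<lambda>w. repairs q w i) \<in> random_seed \<rightarrow>\<^sub>M count_space UNIV"
proof (induction q)
  case (Cons a q)
  have [measurable]: "Measurable.pred random_seed (\<lambda>w. covers a (rounding (a # q) w))"
    unfolding covers_def rounding_def by measurable
  note Cons [measurable]
  show ?case by simp
qed simp

lemma solution_measurable [measurable]:
  "(\<lambda>w. solution q w i) \<in> random_seed \<rightarrow>\<^sub>M count_space UNIV"
  unfolding solution_def rounding_def by measurable

lemma max_col_count_ge: "2 \<le> max_col_count q" "i < n \<Longrightarrow> col_count q i \<le> max_col_count q"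
  unfolding max_col_count_def by (intro Max_ge; auto)+

lemma max_col_count_mono: "max_col_count q \<le> max_col_count (a # q)"
proof -
  have "col_count q i \<le> max_col_count (a # q)" if "i < n" for i
    using max_col_count_ge(2)[OF that, of "a # q"] by (simp add: col_count_def split: if_splits)
  then show ?thesis
    using max_col_count_ge(1)[of "a # q"] by (subst max_col_count_def) auto
qed

lemma boost_mono: "boost q \<le> boost (a # q)"
  unfolding boost_def using max_col_count_mono[of q a] max_col_count_ge(1)[of q] by (auto intro!: ln_mono)

lemma boost_ge: "16 \<le> boost q"
  unfolding boost_def using max_col_count_ge(1)[of q] by simp

text \<open>The rank \<open>r\<close> of a row among those containing \<open>i\<close> is at most the current column
  sparsity, so the right-hand side telescopes over the rows containing \<open>i\<close>.\<close>

lemma repair_rate: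
  assumes "i < n" "a i \<noteq> 0"
  shows "exp 1 * exp (- boost (a # q) / 4) * (2 * boost (a # q))
    \<le> 16 * (1 / (col_count q i + 1) - 1 / (col_count (a # q) i + 1))"
proof -
  define L where "L = real (max_col_count (a # q))"
  \<comment> \<open>With \<open>8 * t\<close> as the boost, the left-hand side is
    \<open>16 * t * exp (1 - 2 * t)\<close>: the factor \<open>exp (1 - t)\<close> absorbs
    \<open>t\<close>, and \<open>exp (- t)\<close> gives inverse-square decay in
    \<open>L\<close>.\<close>
  define t where "t = boost (a # q) / 8"
  define r where "r = real (col_count q i + 1)"
  have L: "2 \<le> L" using max_col_count_ge(1)[of "a # q"] by (simp add: L_def)
  have r: "1 \<le> r" "r \<le> L"
    using max_col_count_ge(2)[OF assms(1), of "a # q"] assms by (auto simp: r_def L_def col_count_def)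
  have t2: "t = 2 * ln L + 2" by (simp add: t_def boost_def L_def)
  have "t * exp (1 - t) \<le> exp (t - 1) * exp (1 - t)"
    using exp_ge_add_one_self[of "t - 1"] by (intro mult_right_mono) auto
  then have te: "t * exp (1 - t) \<le> 1" by (simp add: exp_add[symmetric])
  have "exp 1 * exp (- boost (a # q) / 4) * (2 * boost (a # q)) = 16 * (t * exp (1 - t)) * exp (- t)"
    by (simp add: t_def exp_add[symmetric] algebra_simps)
  also have "\<dots> \<le> 16 * 1 * exp (- t)" using te by (intro mult_right_mono mult_left_mono) auto
  also have "exp (- t) \<le> 1 / (L * (L + 1))"
  proof -
    have "L * (L + 1) \<le> L * L * exp 2"
    proof -
      have "2 \<le> exp (2::real)" using exp_ge_add_one_self[of 2] by simp
      then have "L * 2 \<le> L * exp 2" using L by (intro mult_left_mono) auto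
      then have "L + 1 \<le> L * exp 2" using L by linarith
      then have "L * (L + 1) \<le> L * (L * exp 2)" using L by (intro mult_left_mono) auto
      then show ?thesis by (simp only: mult.assoc)
    qed
    moreover have "exp t = L * L * exp 2"
      unfolding t2 mult_2[of "ln L"] exp_add using L by simp
    ultimately have "L * (L + 1) \<le> exp t" by simp
    then show ?thesis using L by (simp add: exp_minus divide_simps)
  qed
  also have "1 / (L * (L + 1)) \<le> 1 / (r * (r + 1))"
    using r by (intro divide_left_mono mult_mono) auto
  also have "1 / (r * (r + 1)) = 1 / r - 1 / (r + 1)" using r by (simp add: divide_simps)
  finally show ?thesis using assms by (simp add: r_def col_count_def add.commute)
qed

end

section \<open>Invariants and expected cost along a history\<close>

context covering_instance
begin

lemma fractional_nonneg:
  assumes "feasible q z"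
  shows "(i < n \<longrightarrow> 0 \<le> fractional q i) \<and> (i < n \<longrightarrow> c i = 0 \<longrightarrow> U i \<le> fractional q i)"
  using assms
proof (induction q arbitrary: i)
  case Nil
  then show ?case using U_nonneg by simp
next
  case (Cons a q)
  have IH: "\<And>i. i < n \<Longrightarrow> 0 \<le> fractional q i" "\<And>i. i < n \<Longrightarrow> c i = 0 \<Longrightarrow> U i \<le> fractional q i"
    using Cons.IH Cons.prems by (auto simp: feasible_Cons)
  have "fractional q i \<le> fractional (a # q) i"
    unfolding fractional.simps
    by (rule raise_until(2)[where z = z]) (use Cons.prems IH boost_ge[of "a # q"] in \<open>auto simp: feasible_def\<close>)
  then show ?case using IH[of i] by (auto intro: order_trans)
qed

context
  fixes a q z
  assumes feas: "feasible (a # q) z"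
begin

lemma fractional_prev:
  "\<And>i. i < n \<Longrightarrow> 0 \<le> fractional q i"  "\<And>i. i < n \<Longrightarrow> c i = 0 \<Longrightarrow> U i \<le> fractional q i"
  "\<And>i. i < n \<Longrightarrow> 0 \<le> a i" "1 \<le> boost (a # q)" "in_box z" "covers a z"
  using fractional_nonneg[of q z] feas boost_ge[of "a # q"] by (auto simp: feasible_def)

lemma fractional_Cons:
  shows "kc_half_satisfied (boost (a # q)) a (fractional (a # q))"
    and "fractional q i \<le> fractional (a # q) i"
    and "card (supp a) \<le> K \<Longrightarrow> cost (fractional q) \<le> 6 * potential K z (fractional q) \<Longrightarrow>
      cost (fractional (a # q)) \<le> 6 * potential K z (fractional (a # q))"
  unfolding fractional.simps
  using raise_until[OF fractional_prev(3,1,4,2,5,6)] by blast+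

text \<open>The boost and the fractional vector both increase, and the thresholds stay the
  same.\<close>

lemma rounding_mono:
  assumes i: "i < n" shows "rounding q w i \<le> rounding (a # q) w i"
proof -
  have "boost q * fractional q i \<le> boost (a # q) * fractional (a # q) i"
    using boost_mono[of q a] boost_ge[of q] fractional_Cons(2)[of i] fractional_prev(1)[OF i]
    by (intro mult_mono) auto
  then show ?thesis unfolding rounding_def rounded_def by (intro round_at_mono) auto
qed

lemma fractional_head_nonneg: "i < n \<Longrightarrow> 0 \<le> fractional (a # q) i"
  using fractional_prev(1) fractional_Cons(2) order_trans by blast

lemma prob_not_covers_rounding:
  "measure random_seed {w. \<not> covers a (rounding (a # q) w)} \<le> exp 1 * exp (- boost (a # q) / 4)"
  unfolding rounding_def
  using prob_not_covers_rounded[OF fractional_prev(3) fractional_head_nonneg _ fractional_Cons(1)] fractional_prev(4)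
  by simp

lemma cost_repair_head:
  "cost (\<lambda>i. repair a i) \<le> 2 * boost (a # q) * (\<Sum>i\<in>supp a. c i * fractional (a # q) i)"
proof (rule cost_repair[OF fractional_prev(5,6) fractional_head_nonneg])
  have "exp 1 * exp (- boost (a # q) / 4) = exp (- (boost (a # q) / 4 - 1))"
    by (simp add: exp_add[symmetric])
  also have "\<dots> \<le> exp (- 1)" using boost_ge[of "a # q"] by simp
  also have "\<dots> \<le> 1 / 2" using exp_ge_add_one_self[of 1] by (simp add: exp_minus divide_simps)
  finally show "measure random_seed {w. \<not> covers a (rounded (boost (a # q)) (fractional (a # q)) w)} \<le> 1/2"
    using prob_not_covers_rounding unfolding rounding_def by linarith
qed (use fractional_prev(4) in auto)

end

context
  fixes q z
  assumes feas: "feasible q z"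
begin

lemma fractional_ge_0: "i < n \<Longrightarrow> 0 \<le> fractional q i"
  using fractional_nonneg feas by blast

lemma rounding_in_box: "in_box (rounding q w)"
  unfolding rounding_def using boost_ge[of q] by (intro rounded_in_box fractional_ge_0) auto

lemma repairs_nonneg: "i < n \<Longrightarrow> 0 \<le> repairs q w i"
  using feas
proof (induction q)
  case (Cons a q)
  have "in_box (repair a)" using Cons.prems by (intro repair_in_box[where z = z]) (auto simp: feasible_def)
  then show ?case using Cons by (auto simp: in_box_def feasible_Cons)
qed simp

lemma solution_in_box: "in_box (solution q w)"
  using rounding_in_box[of w] repairs_nonneg U_nonneg by (auto simp: in_box_def solution_def)

text \<open>The comparison of the cost with six times the potential is invariant over arrivals: the
  initial cost is zero, as only zero-cost entries can be positive, and each growth phase preserves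
  it. \<open>K\<close> occurs only in the analysis, not in the algorithm.\<close>

lemma cost_fractional:
  assumes "\<And>a. a \<in> set q \<Longrightarrow> card (supp a) \<le> K"
  shows "cost (fractional q) \<le> 6 * ln (1 + 3 * real K) * cost z"
proof -
  have "cost (fractional q) \<le> 6 * potential K z (fractional q)"
    using assms feas
  proof (induction q)
    case Nil
    have "cost (fractional []) = 0" by (auto simp: cost_def intro!: sum.neutral)
    moreover have "0 \<le> potential K z (fractional [])"
      using U_nonneg Nil by (intro potential_bounds) (auto simp: feasible_def)
    ultimately show ?case by linarith
  next
    case (Cons a q)
    then show ?case by (intro fractional_Cons(3)) (auto simp: feasible_Cons)
  qed
  also have "potential K z (fractional q) \<le> ln (1 + 3 * real K) * cost z"
    using fractional_ge_0 feas by (intro potential_bounds) (auto simp: feasible_def)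
  finally show ?thesis by simp
qed

end

lemma solution_mono:
  assumes feas: "feasible (a # q) z" and i: "i < n"
  shows "solution q w i \<le> solution (a # q) w i"
proof -
  have "in_box (repair a)" using feas by (intro repair_in_box[where z = z]) (auto simp: feasible_def)
  then show ?thesis
    using rounding_mono[OF feas i, of w] i unfolding solution_def by (auto simp: in_box_def min_le_iff_disj)
qed

lemma covers_mono:
  assumes "covers a y" "\<And>i. i < n \<Longrightarrow> 0 \<le> a i" "\<And>i. i < n \<Longrightarrow> y i \<le> y' i"
  shows "covers a y'"
proof -
  have "(\<Sum>i<n. a i * y i) \<le> (\<Sum>i<n. a i * y' i)" using assms by (intro sum_mono mult_left_mono) auto
  then show ?thesis using assms(1) by (simp add: covers_def)
qed

text \<open>An older row stays covered by monotonicity; the newest one is covered by the rounding or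
  else by its repair, each dominated by the solution.\<close>

lemma covers_solution:
  assumes "feasible q z" "b \<in> set q"
  shows "covers b (solution q w)"
  using assms
proof (induction q)
  case (Cons a q)
  show ?case
  proof (cases "b = a")
    case False
    then have "covers b (solution q w)" using Cons by (simp add: feasible_Cons)
    then show ?thesis
      by (rule covers_mono) (use Cons.prems solution_mono[OF Cons.prems(1)] in \<open>auto simp: feasible_def\<close>)
  next
    case True
    have rb: "in_box (rounding (a # q) w)" by (rule rounding_in_box[OF Cons.prems(1)])
    have r0: "\<And>i. i < n \<Longrightarrow> 0 \<le> repairs (a # q) w i" "\<And>i. i < n \<Longrightarrow> 0 \<le> repairs q w i"
      using repairs_nonneg[OF Cons.prems(1)] repairs_nonneg[of q z] Cons.prems(1) by (auto simp: feasible_Cons simp del: repairs.simps)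
    have rep: "in_box (repair a)" "covers a (repair a)"
      using Cons.prems repair_in_box[of z a] covers_repair[of z a] by (auto simp: feasible_def)
    show ?thesis
    proof (cases "covers a (rounding (a # q) w)")
      case cov: True
      have "covers a (solution (a # q) w)"
        by (rule covers_mono[OF cov]) (use Cons.prems rb r0 in \<open>auto simp: solution_def in_box_def feasible_def simp del: repairs.simps\<close>)
      then show ?thesis using True by simp
    next
      case ncov: False
      have "covers a (solution (a # q) w)"
        by (rule covers_mono[OF rep(2)]) (use Cons.prems rb r0(2) rep(1) ncov in \<open>auto simp: solution_def in_box_def feasible_def\<close>)
      then show ?thesis using True by simp
    qed
  qed
qed simp

text \<open>Each repair is charged to the columns of its row with the weights of
  \<open>repair_rate\<close>, which telescope to at most \<open>16\<close> per column. Expectations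
  are simply added, so dependence between the failures of different rows is harmless.\<close>

lemma repairs_expected_cost:
  assumes feas: "feasible q z"
  shows "integrable random_seed (\<lambda>w. cost (\<lambda>i. repairs q w i)) \<and>
    (\<integral>w. cost (\<lambda>i. repairs q w i) \<partial>random_seed)
      \<le> (\<Sum>i<n. c i * fractional q i * (16 * (1 - 1 / (col_count q i + 1))))"
  using assms
proof (induction q)
  case Nil
  then show ?case by (simp add: cost_def col_count_def)
next
  case (Cons a q)
  interpret prob_space random_seed by (rule prob_space_random_seed)
  let ?F = "{w. \<not> covers a (rounding (a # q) w)}" let ?M = "cost (\<lambda>i. repair a i)"
  let ?\<beta> = "boost (a # q)" let ?x = "fractional (a # q)"
  have IH: "integrable random_seed (\<lambda>w. cost (\<lambda>i. repairs q w i))"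
    "(\<integral>w. cost (\<lambda>i. repairs q w i) \<partial>random_seed)
      \<le> (\<Sum>i<n. c i * fractional q i * (16 * (1 - 1 / (col_count q i + 1))))"
    using Cons by (auto simp: feasible_Cons)
  have F: "?F \<in> events" unfolding rounding_def by (rule covers_rounded_sets)
  have eq: "cost (\<lambda>i. repairs (a # q) w i) = cost (\<lambda>i. repairs q w i) + ?M * indicator ?F w" for w
    by (cases "covers a (rounding (a # q) w)") (simp_all add: cost_def distrib_left sum.distrib)
  have int: "integrable random_seed (\<lambda>w. ?M * indicator ?F w)"
    using F by (intro integrable_mult_right integrable_real_indicator) (auto simp: emeasure_eq_measure)
  have x0: "0 \<le> c i * ?x i" if "i < n" for i
    using fractional_head_nonneg[OF Cons.prems that] c_nonneg[OF that] by simp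
  have sub: "supp a \<subseteq> {..<n}" by (auto simp: supp_def)
  have M0: "0 \<le> ?M"
    using repair_in_box[of z a] Cons.prems c_nonneg
    by (auto simp: cost_def in_box_def feasible_def intro!: sum_nonneg)
  have "?M * prob ?F \<le> (2 * ?\<beta> * (\<Sum>i\<in>supp a. c i * ?x i)) * (exp 1 * exp (- ?\<beta> / 4))"
    using cost_repair_head[OF Cons.prems] prob_not_covers_rounding[OF Cons.prems] M0
    by (intro mult_mono) auto
  also have "\<dots> = (\<Sum>i\<in>supp a. c i * ?x i * (exp 1 * exp (- ?\<beta> / 4) * (2 * ?\<beta>)))"
    unfolding sum_distrib_left sum_distrib_right by (intro sum.cong refl) (simp only: mult_ac)
  also have "\<dots> \<le> (\<Sum>i\<in>supp a. c i * ?x i * (16 * (1 / (col_count q i + 1) - 1 / (col_count (a # q) i + 1))))"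
  proof (intro sum_mono mult_left_mono)
    fix i assume "i \<in> supp a"
    then have i: "i < n" "a i \<noteq> 0" by (auto simp: supp_def)
    from repair_rate[of i a q, OF i] show "exp 1 * exp (- ?\<beta> / 4) * (2 * ?\<beta>)
      \<le> 16 * (1 / (col_count q i + 1) - 1 / (col_count (a # q) i + 1))" .
    show "0 \<le> c i * ?x i" by (rule x0[OF i(1)])
  qed
  \<comment> \<open>Outside the support the column count does not change and the telescoping term
    vanishes.\<close>
  also have "\<dots> = (\<Sum>i<n. c i * ?x i * (16 * (1 / (col_count q i + 1) - 1 / (col_count (a # q) i + 1))))"
    by (rule sum.mono_neutral_left) (use sub in \<open>auto simp: supp_def col_count_def\<close>)
  finally have rep: "?M * prob ?F \<le> \<dots>" .
  have "(\<integral>w. cost (\<lambda>i. repairs (a # q) w i) \<partial>random_seed)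
      = (\<integral>w. cost (\<lambda>i. repairs q w i) \<partial>random_seed) + ?M * prob ?F"
    unfolding eq using IH(1) int F by (subst Bochner_Integration.integral_add) auto
  \<comment> \<open>Earlier charges refer to the older, smaller fractional vector; their weights are
    nonnegative, so they may be restated with the current one.\<close>
  also have "\<dots> \<le> (\<Sum>i<n. c i * ?x i * (16 * (1 - 1 / (col_count q i + 1))))
      + (\<Sum>i<n. c i * ?x i * (16 * (1 / (col_count q i + 1) - 1 / (col_count (a # q) i + 1))))"
  proof (rule add_mono[OF order_trans[OF IH(2)] rep], intro sum_mono mult_right_mono mult_left_mono)
    fix i assume "i \<in> {..<n}"
    then show "0 \<le> c i" using c_nonneg by simp
    show "fractional q i \<le> ?x i" by (rule fractional_Cons(2)[OF Cons.prems])
  qed (auto simp: divide_simps)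
  also have "\<dots> = (\<Sum>i<n. c i * ?x i * (16 * (1 - 1 / (col_count (a # q) i + 1))))"
    unfolding sum.distrib[symmetric] by (intro sum.cong refl) (simp add: algebra_simps)
  finally have "(\<integral>w. cost (\<lambda>i. repairs (a # q) w i) \<partial>random_seed)
      \<le> (\<Sum>i<n. c i * ?x i * (16 * (1 - 1 / (col_count (a # q) i + 1))))" .
  moreover have "integrable random_seed (\<lambda>w. cost (\<lambda>i. repairs (a # q) w i))"
    unfolding eq using IH(1) int by (rule Bochner_Integration.integrable_add)
  ultimately show ?case by blast
qed

text \<open>Rounding costs at most \<open>boost q\<close> times and the repairs at most
  \<open>16\<close> times the fractional cost; \<open>cost_fractional\<close> supplies the factor
  \<open>6 * ln (1 + 3 * K)\<close>.\<close>

lemma solution_expected_cost: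
  assumes feas: "feasible q z"
    and K: "\<And>a. a \<in> set q \<Longrightarrow> card (supp a) \<le> K"
  shows "(\<integral>w. cost (\<lambda>i. solution q w i) \<partial>random_seed)
    \<le> 96 * (ln (max_col_count q) + 2) * ln (1 + 3 * real K) * cost z"
proof -
  interpret prob_space random_seed by (rule prob_space_random_seed)
  have x: "0 \<le> fractional q i" if "i < n" for i using fractional_ge_0[OF feas that] by blast
  have int1: "integrable random_seed (\<lambda>w. cost (\<lambda>i. rounding q w i))"
    unfolding cost_def rounding_def rounded_def
    by (intro Bochner_Integration.integrable_sum integrable_mult_right integrable_round_at)
  have int2: "integrable random_seed (\<lambda>w. cost (\<lambda>i. repairs q w i))"
    and rep: "(\<integral>w. cost (\<lambda>i. repairs q w i) \<partial>random_seed)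
      \<le> (\<Sum>i<n. c i * fractional q i * (16 * (1 - 1 / (col_count q i + 1))))"
    using repairs_expected_cost[OF feas] by auto
  have "(\<integral>w. cost (\<lambda>i. solution q w i) \<partial>random_seed)
      \<le> (\<integral>w. cost (\<lambda>i. rounding q w i) + cost (\<lambda>i. repairs q w i) \<partial>random_seed)"
  proof (rule integral_mono')
    fix w
    have "0 \<le> cost (\<lambda>i. rounding q w i)"
      using rounding_in_box[OF feas] c_nonneg by (auto simp: cost_def in_box_def intro!: sum_nonneg)
    moreover have "0 \<le> cost (\<lambda>i. repairs q w i)"
      using repairs_nonneg[OF feas] c_nonneg by (auto simp: cost_def intro!: sum_nonneg)
    ultimately show "0 \<le> cost (\<lambda>i. rounding q w i) + cost (\<lambda>i. repairs q w i)" by simp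
    show "cost (\<lambda>i. solution q w i) \<le> cost (\<lambda>i. rounding q w i) + cost (\<lambda>i. repairs q w i)"
      unfolding cost_def sum.distrib[symmetric] distrib_left[symmetric]
      using c_nonneg by (intro sum_mono mult_left_mono) (auto simp: solution_def)
  qed (use int1 int2 in auto)
  also have "\<dots> = (\<integral>w. cost (\<lambda>i. rounding q w i) \<partial>random_seed) + (\<integral>w. cost (\<lambda>i. repairs q w i) \<partial>random_seed)"
    using int1 int2 by (rule Bochner_Integration.integral_add)
  also have "\<dots> \<le> boost q * cost (fractional q) + 16 * cost (fractional q)"
  proof (rule add_mono)
    show "(\<integral>w. cost (\<lambda>i. rounding q w i) \<partial>random_seed) \<le> boost q * cost (fractional q)"
      unfolding cost_def rounding_def using x boost_ge[of q] by (intro integral_cost_rounded_le) auto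
    have "(\<Sum>i<n. c i * fractional q i * (16 * (1 - 1 / (col_count q i + 1))))
        \<le> (\<Sum>i<n. c i * fractional q i * (16 * 1))"
      using c_nonneg x by (intro sum_mono mult_left_mono) auto
    then show "(\<integral>w. cost (\<lambda>i. repairs q w i) \<partial>random_seed) \<le> 16 * cost (fractional q)"
      using rep by (simp add: cost_def sum_distrib_left mult_ac)
  qed
  also have "\<dots> = 16 * (ln (max_col_count q) + 2) * cost (fractional q)"
    by (simp add: boost_def algebra_simps)
  also have "\<dots> \<le> 16 * (ln (max_col_count q) + 2) * (6 * ln (1 + 3 * real K) * cost z)"
    using cost_fractional[OF feas K] max_col_count_ge(1)[of q]
    by (intro mult_left_mono) auto
  finally show ?thesis by (simp only: mult_ac)
qed

end

section \<open>Transfer to matrices and vectors\<close>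

definition row_fun :: "real vec \<Rightarrow> nat \<Rightarrow> real" where
  "row_fun r i = r $ i"

text \<open>For integral vectors the bound \<open>u\<close> is equivalent to its floor. The list of
  rows is reversed because histories start with the most recent row.\<close>

definition online_alg :: online_cip_alg where
  "online_alg w c u rs = Matrix.vec (dim_vec u)
     (covering_box.solution (dim_vec u) (\<lambda>i. c $ i) (\<lambda>i. \<lfloor>u $ i\<rfloor>) (rev (map row_fun rs)) w)"

text \<open>The head takes countably many values, so the list can be assembled one entry at a time
  by a case distinction on the head.\<close>

lemma measurable_map_count_space:
  fixes f :: "'a \<Rightarrow> 'b \<Rightarrow> 'c::countable"
  assumes f: "\<And>x. x \<in> set xs \<Longrightarrow> (\<lambda>w. f w x) \<in> M \<rightarrow>\<^sub>M count_space UNIV"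
  shows "(\<lambda>w. map (f w) xs) \<in> M \<rightarrow>\<^sub>M count_space UNIV"
  using f
proof (induction xs)
  case (Cons x xs)
  have "(\<lambda>w. (\<lambda>y w. y # map (f w) xs) (f w x) w) \<in> M \<rightarrow>\<^sub>M count_space UNIV"
  proof (rule measurable_compose_countable[where f = "\<lambda>y w. y # map (f w) xs"])
    fix y :: 'c
    show "(\<lambda>w. y # map (f w) xs) \<in> M \<rightarrow>\<^sub>M count_space UNIV"
      by (rule measurable_compose[OF Cons.IH]) (use Cons.prems in auto)
  qed (use Cons.prems in auto)
  then show ?case by simp
qed simp

lemma randomized_online_alg: "randomized_online_alg online_alg"
  unfolding randomized_online_alg_def
proof (intro allI)
  fix c u :: "real vec" and rs
  let ?f = "covering_box.solution (dim_vec u) (\<lambda>i. c $ i) (\<lambda>i. \<lfloor>u $ i\<rfloor>) (rev (map row_fun rs))"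
  \<comment> \<open>Factoring through the list of entries reduces measurability of the vector to
    that of its coordinates.\<close>
  have "(\<lambda>w. Matrix.vec (dim_vec u) ((!) (map (?f w) [0..<dim_vec u]))) \<in> random_seed \<rightarrow>\<^sub>M count_space UNIV"
    by (rule measurable_compose[OF measurable_map_count_space])
      (auto intro: covering_box.solution_measurable)
  also have "(\<lambda>w. Matrix.vec (dim_vec u) ((!) (map (?f w) [0..<dim_vec u]))) = (\<lambda>w. online_alg w c u rs)"
    by (auto simp: online_alg_def fun_eq_iff intro!: eq_vecI)
  finally show "(\<lambda>w. online_alg w c u rs) \<in> random_seed \<rightarrow>\<^sub>M count_space UNIV" .
qed

lemma cip_solutions_iff:
  assumes "A \<in> carrier_mat m n" "u \<in> carrier_vec n"
  shows "z \<in> cip_solutions A u \<longleftrightarrow> z \<in> carrier_vec n \<and> (\<forall>i<n. 0 \<le> z $ i \<and> z $ i \<le> \<lfloor>u $ i\<rfloor>) \<and>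
    (\<forall>j<m. 1 \<le> (\<Sum>i<n. A $$ (j, i) * z $ i))"
proof (cases "z \<in> carrier_vec n")
  case True
  have "(A *\<^sub>v map_vec real_of_int z) $ j = (\<Sum>i<n. A $$ (j, i) * z $ i)" if "j < m" for j
    using assms that True by (auto simp: scalar_prod_def atLeast0LessThan intro!: sum.cong)
  then show ?thesis
    using assms True by (auto simp: cip_solutions_def less_eq_vec_def le_floor_iff)
qed (use assms in \<open>auto simp: cip_solutions_def\<close>)

lemma cip_cost_eq:
  assumes "z \<in> carrier_vec n"
  shows "cip_cost c z = covering_box.cost n (\<lambda>i. c $ i) (\<lambda>i. z $ i)"
  using assms by (auto simp: cip_cost_def covering_box.cost_def scalar_prod_def atLeast0LessThan)

context
  fixes A :: "real mat" and c u :: "real vec" and m n :: nat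
  assumes A: "A \<in> carrier_mat m n" "0\<^sub>m m n \<le> A" and c: "c \<in> carrier_vec n" "0\<^sub>v n \<le> c"
    and u: "u \<in> carrier_vec n" "0\<^sub>v n \<le> u"
begin

interpretation covering_instance n "\<lambda>i. c $ i" "\<lambda>i. \<lfloor>u $ i\<rfloor>"
  using c u by unfold_locales (auto simp: less_eq_vec_def)

abbreviation (input) history :: "nat \<Rightarrow> (nat \<Rightarrow> real) list" where
  "history j \<equiv> rev (map row_fun (take j (rows A)))"

lemma online_alg_index:
  "online_alg w c u rs \<in> carrier_vec n"
  "i < n \<Longrightarrow> online_alg w c u rs $ i = solution (rev (map row_fun rs)) w i"
  using u by (auto simp: online_alg_def)

lemma set_history: "j \<le> m \<Longrightarrow> set (history j) = (\<lambda>k. row_fun (row A k)) ` {..<j}"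
  using A by (auto simp: rows_def take_map take_upt simp flip: atLeast0LessThan)

lemma feasible_history:
  assumes z: "z \<in> cip_solutions A u" and j: "j \<le> m"
  shows "feasible (history j) (\<lambda>i. z $ i)"
  using A z j cip_solutions_iff[OF A(1) u(1)]
  unfolding feasible_def set_history[OF j]
  by (auto simp: in_box_def covers_def row_fun_def less_eq_mat_def)

lemma online_alg_maintains:
  assumes z: "z \<in> cip_solutions A u"
  shows "maintains_solution online_alg A c u"
  unfolding maintains_solution_def
proof (intro ballI conjI allI impI)
  fix w j assume j: "j \<le> dim_row A"
  then have jm: "j \<le> m" using A by simp
  let ?rs = "take j (rows A)" let ?B = "mat_of_rows (dim_col A) ?rs"
  have B: "?B \<in> carrier_mat j n" using A jm by auto
  have Bi: "?B $$ (k, i) = row_fun (row A k) i" if "k < j" "i < n" for k i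
    using A jm that by (simp add: mat_of_rows_def row_fun_def)
  note feas = feasible_history[OF z jm]
  have "covers (row_fun (row A k)) (solution (history j) w)" if "k < j" for k
    using feas by (rule covers_solution) (use that jm in \<open>auto simp only: set_history\<close>)
  then show "online_alg w c u ?rs \<in> cip_solutions ?B u"
    using solution_in_box[OF feas, of w] online_alg_index
    by (simp add: cip_solutions_iff[OF B u(1)] in_box_def covers_def Bi)
next
  fix w j assume j: "j < dim_row A"
  then have jm: "Suc j \<le> m" using A by simp
  have h: "history (Suc j) = row_fun (rows A ! j) # history j"
    using j by (simp add: take_Suc_conv_app_nth)
  have "solution (history j) w i \<le> solution (history (Suc j)) w i" if "i < n" for i
    using solution_mono[OF feasible_history[OF z jm, unfolded h] that] unfolding h .
  then show "online_alg w c u (take j (rows A)) \<le> online_alg w c u (take (Suc j) (rows A))"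
    using u by (auto simp: less_eq_vec_def online_alg_def)
qed

lemma card_supp_le:
  assumes "k < m" shows "card (supp (row_fun (row A k))) \<le> row_sparsity A"
proof -
  have "supp (row_fun (row A k)) = {i. i < dim_col A \<and> A $$ (k, i) \<noteq> 0}"
    using A assms by (auto simp: supp_def row_fun_def)
  then show ?thesis using A assms unfolding row_sparsity_def by (intro Max_ge) auto
qed

lemma max_col_count_le: "max_col_count (history m) \<le> max 2 (col_sparsity A)"
proof -
  have "col_count (history m) i \<le> col_sparsity A" if "i < n" for i
  proof -
    have "col_count (history m) i = card {j. j < dim_row A \<and> A $$ (j, i) \<noteq> 0}"
      using A that
      by (auto simp: col_count_def rev_filter[symmetric] length_filter_conv_card row_fun_def intro!: arg_cong[where f = card])
    then show ?thesis using A that unfolding col_sparsity_def by (intro Max_ge) auto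
  qed
  then show ?thesis unfolding max_col_count_def by (subst Max_le_iff) (auto simp: le_max_iff_disj)
qed

lemma online_alg_expected_cost:
  assumes z: "z \<in> cip_solutions A u"
  shows "(\<integral>w. cip_cost c (online_alg w c u (rows A)) \<partial>random_seed)
    \<le> 864 * log 2 (real (max 2 (row_sparsity A))) * log 2 (real (max 2 (col_sparsity A))) * cip_cost c z"
proof -
  let ?k = "max 2 (row_sparsity A)" and ?l = "max 2 (col_sparsity A)"
  have m: "history m = rev (map row_fun (rows A))" using A by simp
  have zc: "z \<in> carrier_vec n" using z cip_solutions_iff[OF A(1) u(1)] by blast
  have "0 \<le> cip_cost c z"
    using z cip_solutions_iff[OF A(1) u(1)] c_nonneg
    by (auto simp: cip_cost_eq[OF zc] cost_def intro!: sum_nonneg)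
  have ln2: "ln (2::real) \<le> 1" using ln_le_minus_one[of "2::real"] by simp
  have log_ge: "ln x \<le> log 2 x" "1 \<le> log 2 x" if "2 \<le> x" for x :: real
  proof -
    have "ln x * ln 2 \<le> ln x" using that ln2 mult_left_mono[of "ln 2" 1 "ln x"] by simp
    then show "ln x \<le> log 2 x" by (simp add: log_def le_divide_eq)
    show "1 \<le> log 2 x" using that by simp
  qed
  \<comment> \<open>The summand \<open>2\<close> is absorbed because the binary logarithm of
    \<open>?l\<close> is at least \<open>1\<close>.\<close>
  have ll: "ln (max_col_count (history m)) + 2 \<le> 3 * log 2 ?l"
  proof -
    have "ln (max_col_count (history m)) \<le> ln ?l"
      using max_col_count_le max_col_count_ge(1)[of "history m"] by (intro ln_mono) auto
    then show ?thesis using log_ge[of "real ?l"] by linarith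
  qed
  \<comment> \<open>For \<open>x \<ge> 2\<close>, \<open>1 + 3 * x \<le> 4 * x \<le> x ^ 3\<close>,
    whence the factor \<open>3\<close>. Together with \<open>ll\<close> this explains
    \<open>864 = 96 * 3 * 3\<close>.\<close>
  have kk: "ln (1 + 3 * real ?k) \<le> 3 * log 2 ?k"
  proof -
    let ?x = "real ?k"
    have x: "2 \<le> ?x" by simp
    have "2 * 2 \<le> ?x * ?x" using x by (intro mult_mono) auto
    then have "4 * ?x \<le> ?x * ?x * ?x" using x by (intro mult_right_mono) auto
    then have "1 + 3 * ?x \<le> ?x ^ 3" using x by (simp only: power3_eq_cube)
    then have "ln (1 + 3 * ?x) \<le> ln (?x ^ 3)" using x by (intro ln_mono) auto
    also have "\<dots> = 3 * ln ?x" using x by (simp add: ln_realpow)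
    finally show ?thesis using log_ge(1)[OF x] by linarith
  qed
  have "(\<integral>w. cip_cost c (online_alg w c u (rows A)) \<partial>random_seed)
      = (\<integral>w. cost (\<lambda>i. solution (history m) w i) \<partial>random_seed)"
    unfolding m cip_cost_eq[OF online_alg_index(1)]
    by (intro Bochner_Integration.integral_cong refl) (simp add: cost_def online_alg_index(2))
  also have "\<dots> \<le> 96 * (ln (max_col_count (history m)) + 2) * ln (1 + 3 * real ?k) * cost (\<lambda>i. z $ i)"
  proof (rule solution_expected_cost[OF feasible_history[OF z order_refl]])
    fix a assume "a \<in> set (history m)"
    then obtain k where k: "k < m" "a = row_fun (row A k)" using set_history[OF order_refl] by auto
    then show "card (supp a) \<le> ?k" using card_supp_le[OF k(1)] by simp
  qed
  also have "cost (\<lambda>i. z $ i) = cip_cost c z" using cip_cost_eq[OF zc] by simp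
  also have "96 * (ln (max_col_count (history m)) + 2) * ln (1 + 3 * real ?k) * cip_cost c z
      \<le> 96 * (3 * log 2 ?l) * (3 * log 2 ?k) * cip_cost c z"
    using ll kk log_ge(2)[of "real ?l"] max_col_count_ge(1)[of "history m"] \<open>0 \<le> cip_cost c z\<close>
    by (intro mult_right_mono mult_mono mult_nonneg_nonneg ln_ge_zero) auto
  finally show ?thesis by (simp only: mult_ac)
qed

end

theorem theorem3:
  shows "\<exists>(alg :: online_cip_alg) (C :: real).
    randomized_online_alg alg \<and>
    (\<forall>(m :: nat) (n :: nat) (A :: real mat) (c :: real vec) (u :: real vec).
       A \<in> carrier_mat m n \<longrightarrow> c \<in> carrier_vec n \<longrightarrow> u \<in> carrier_vec n \<longrightarrow>
       0\<^sub>m m n \<le> A \<longrightarrow> 0\<^sub>v n \<le> c \<longrightarrow> 0\<^sub>v n \<le> u \<longrightarrow>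
       cip_solutions A u \<noteq> {} \<longrightarrow>
       maintains_solution alg A c u \<and>
       (\<integral>w. cip_cost c (alg w c u (rows A)) \<partial>random_seed)
         \<le> C * log 2 (real (max 2 (row_sparsity A)))
             * log 2 (real (max 2 (col_sparsity A))) * cip_opt A c u)"
proof (intro exI conjI allI impI)
  show "randomized_online_alg online_alg" by (rule randomized_online_alg)
  fix m n and A :: "real mat" and c u :: "real vec"
  assume A: "A \<in> carrier_mat m n" and c: "c \<in> carrier_vec n" and u: "u \<in> carrier_vec n"
    and nonneg: "0\<^sub>m m n \<le> A" "0\<^sub>v n \<le> c" "0\<^sub>v n \<le> u" and ne: "cip_solutions A u \<noteq> {}"
  show "maintains_solution online_alg A c u"
    using ne online_alg_maintains[OF A nonneg(1) c nonneg(2) u nonneg(3)] by blast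
  let ?E = "\<integral>w. cip_cost c (online_alg w c u (rows A)) \<partial>random_seed"
  let ?D = "864 * log 2 (real (max 2 (row_sparsity A))) * log 2 (real (max 2 (col_sparsity A)))"
  have pos: "0 < ?D" by (intro mult_pos_pos) auto
  \<comment> \<open>The bound holds against every solution; dividing by the positive factor passes
    it to the infimum without choosing an optimal solution.\<close>
  have "?E / ?D \<le> cip_opt A c u"
    unfolding cip_opt_def
  proof (rule cInf_greatest)
    fix v assume "v \<in> cip_cost c ` cip_solutions A u"
    then obtain z where z: "z \<in> cip_solutions A u" "v = cip_cost c z" by blast
    have "?E \<le> ?D * v"
      using online_alg_expected_cost[OF A nonneg(1) c nonneg(2) u nonneg(3) z(1)] z(2) by simp
    then show "?E / ?D \<le> v" using pos by (simp only: pos_divide_le_eq mult.commute)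
  qed (use ne in auto)
  then show "?E \<le> ?D * cip_opt A c u" using pos by (simp only: pos_divide_le_eq mult.commute)
qed

end
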